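(* Let $\mathbb{K}=\mathbb{R}$ or $\mathbb{K}=\mathbb{C}$ and let $V$ be a finite-dimensional $\mathbb{K}$-vector space. Consider the following problem: find generators of $\mathcal{A}(V)$ which can be formed by a suitable symmetry operator from product tensors $U\otimes w$ or $w\otimes U$ with $U\in\mathcal{T}_3V$, $w\in\mathcal{T}_1V$, and generators of $\mathcal{A}'(V)$ which can be formed by a suitable symmetry operator from product tensors $U\otimes W$ or $W\otimes U$ with $U\in\mathcal{T}_3V$, $W\in\mathcal{T}_2V$, where $W$ and $U$ belong to symmetry classes of $\mathcal{T}_2V$ and $\mathcal{T}_3V$ which are defined by minimal right ideals $\mathfrak{r}\subset\mathbb{K}[\mathcal{S}_2]$ and $\hat{\mathfrak{r}}\subset\mathbb{K}[\mathcal{S}_3]$, respectively. A solution of this problem can be constructed at most from such products whose factors $U$, $W$ lie in symmetry classes which belong to the following partitions of $3$ or $2$: For $\mathcal{A}(V)$, products $U\otimes w$, $w\otimes U$: (a) $U\leftrightarrow(2\,1)$. For $\mathcal{A}'(V)$, products $U\otimes W$, $W\otimes U$: (a') $U\leftrightarrow(3)$ and $W\leftrightarrow(2)$ ($U$ and $W$ symmetric); (b') $U\leftrightarrow(2\,1)$ and $W\leftrightarrow(2)$ ($W$ symmetric); (c') $U\leftrightarrow(2\,1)$ and $W\leftrightarrow(1^2)$ ($W$ skew-symmetric).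
   Context: $\mathcal{T}_rV$ is the space of $r$-times covariant tensors ($r$-linear forms) on $V$; $V$ is assumed to possess a fundamental tensor $g\in\mathcal{T}_2V$ (of arbitrary signature) usable for raising and lowering indices. $\mathcal{A}(V)\subset\mathcal{T}_4V$ is the space of algebraic curvature tensors, i.e. all $R$ with $R(w,x,y,z)=-R(w,x,z,y)=R(y,z,w,x)$ and $R(w,x,y,z)+R(w,y,z,x)+R(w,z,x,y)=0$ for all $w,x,y,z\in V$. $\mathcal{A}'(V)\subset\mathcal{T}_5V$ is the space of algebraic covariant derivative curvature tensors, i.e. all $R'$ with $R'(w,x,y,z;u)=-R'(w,x,z,y;u)=R'(y,z,w,x;u)$, $R'(w,x,y,z;u)+R'(w,y,z,x;u)+R'(w,z,x,y;u)=0$ and $R'(w,x,y,z;u)+R'(w,x,z,u;y)+R'(w,x,u,y;z)=0$ for all $u,w,x,y,z\in V$. $\mathbb{K}[\mathcal{S}_r]$ is the group ring of the symmetric group $\mathcal{S}_r$, with product of permutations $(p\circ q)(i)=p(q(i))$. A group ring element $a=\sum_{p\in\mathcal{S}_r}a(p)\,p$ acts on $T\in\mathcal{T}_rV$ as a symmetry operator by $(aT)(v_1,\dots,v_r)=\sum_{p}a(p)\,T(v_{p(1)},\dots,v_{p(r)})$. For a right ideal $\mathfrak{r}\subseteq\mathbb{K}[\mathcal{S}_r]$ for which $aT\neq0$ for some $a\in\mathfrak{r}$, $T\in\mathcal{T}_rV$, the symmetry class defined by $\mathfrak{r}$ is $\mathcal{T}_{\mathfrak{r}}=\{aT\mid a\in\mathfrak{r},\,T\in\mathcal{T}_rV\}$.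 A symmetry class $\mathcal{T}_{\mathfrak{r}}$ belongs to the partition $\lambda\vdash r$ if $\mathfrak{r}$ is contained in the minimal two-sided ideal of $\mathbb{K}[\mathcal{S}_r]$ corresponding to $\lambda$, i.e. the one containing the Young symmetrizers of all Young tableaux with frame $\lambda$ (the Young symmetrizer of a tableau $t$ is $\sum_{p}\sum_{q}\mathrm{sign}(q)\,p\circ q$, with $p$ running over the permutations preserving the rows and $q$ over those preserving the columns of $t$). The notation $U\leftrightarrow\lambda$ means that the symmetry class of $U$ belongs to $\lambda$, and likewise for $W$. *)

theory Defs
  imports
    Complex_Main
    "HOL-Library.Function_Algebras"
    "HOL-Combinatorics.Permutations"
begin

section \<open>Covariant tensors\<close>

text \<open>
  An argument tuple \<open>(v\<^sub>1, \<dots>, v\<^sub>r)\<close> is a function \<open>v :: nat \<Rightarrow> 'v\<close> of which only the values at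
  \<open>1, \<dots>, r\<close> matter. The first condition below makes an \<open>r\<close>-linear form independent of the other
  values, so that equality of tensors is equality of functions. Sums and zero of tensors are the
  pointwise ones of \<^theory>\<open>HOL-Library.Function_Algebras\<close>. The scalars form an arbitrary field here;
  the class \<^class>\<open>real_normed_field\<close> restricts them to \<open>\<real>\<close> or \<open>\<complex>\<close>, which by the theorem of
  Gelfand and Mazur are its only instances up to isomorphism.
\<close>

definition tensors ::
  "('k::field \<Rightarrow> 'v::ab_group_add \<Rightarrow> 'v) \<Rightarrow> nat \<Rightarrow> ((nat \<Rightarrow> 'v) \<Rightarrow> 'k) set" where
  "tensors sc r = {T.
     (\<forall>v w. (\<forall>i\<in>{1..r}. v i = w i) \<longrightarrow> T v = T w) \<and>
     (\<forall>v. \<forall>i\<in>{1..r}. Vector_Spaces.linear sc (*) (\<lambda>x. T (v(i := x))))}"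

definition tensor_span :: "((nat \<Rightarrow> 'v) \<Rightarrow> 'k::field) set \<Rightarrow> ((nat \<Rightarrow> 'v) \<Rightarrow> 'k) set" where
  "tensor_span = module.span (\<lambda>c T v. c * T v)"

text \<open>\<open>m\<close> is the order of the left factor \<open>S\<close>.\<close>

definition tensor_prod ::
  "nat \<Rightarrow> ((nat \<Rightarrow> 'v) \<Rightarrow> 'k::field) \<Rightarrow> ((nat \<Rightarrow> 'v) \<Rightarrow> 'k) \<Rightarrow> (nat \<Rightarrow> 'v) \<Rightarrow> 'k" where
  "tensor_prod m S T = (\<lambda>v. S v * T (\<lambda>i. v (m + i)))"

definition args :: "'v list \<Rightarrow> nat \<Rightarrow> 'v" where
  "args vs = (\<lambda>i. vs ! (i - 1))"

definition symmetric_tensor :: "nat \<Rightarrow> ((nat \<Rightarrow> 'v) \<Rightarrow> 'k::field) \<Rightarrow> bool" where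
  "symmetric_tensor r T \<longleftrightarrow> (\<forall>p v. p permutes {1..r} \<longrightarrow> T (v \<circ> p) = T v)"

definition skew_tensor :: "nat \<Rightarrow> ((nat \<Rightarrow> 'v) \<Rightarrow> 'k::field) \<Rightarrow> bool" where
  "skew_tensor r T \<longleftrightarrow> (\<forall>p v. p permutes {1..r} \<longrightarrow> T (v \<circ> p) = of_int (sign p) * T v)"

text \<open>Algebraic curvature tensors \<open>\<A>(V)\<close> and algebraic covariant derivative curvature tensors
  \<open>\<A>'(V)\<close>; in the latter the fifth argument is the one written after the semicolon.\<close>

definition curvature_tensors ::
  "('k::field \<Rightarrow> 'v::ab_group_add \<Rightarrow> 'v) \<Rightarrow> ((nat \<Rightarrow> 'v) \<Rightarrow> 'k) set" where
  "curvature_tensors sc = {R \<in> tensors sc 4. \<forall>w x y z.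
     R (args [w, x, y, z]) = - R (args [w, x, z, y]) \<and>
     R (args [w, x, y, z]) = R (args [y, z, w, x]) \<and>
     R (args [w, x, y, z]) + R (args [w, y, z, x]) + R (args [w, z, x, y]) = 0}"

definition derivative_curvature_tensors ::
  "('k::field \<Rightarrow> 'v::ab_group_add \<Rightarrow> 'v) \<Rightarrow> ((nat \<Rightarrow> 'v) \<Rightarrow> 'k) set" where
  "derivative_curvature_tensors sc = {R \<in> tensors sc 5. \<forall>u w x y z.
     R (args [w, x, y, z, u]) = - R (args [w, x, z, y, u]) \<and>
     R (args [w, x, y, z, u]) = R (args [y, z, w, x, u]) \<and>
     R (args [w, x, y, z, u]) + R (args [w, y, z, x, u]) + R (args [w, z, x, y, u]) = 0 \<and>
     R (args [w, x, y, z, u]) + R (args [w, x, z, u, y]) + R (args [w, x, u, y, z]) = 0}"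

section \<open>The group ring of the symmetric group\<close>

definition group_ring :: "nat \<Rightarrow> ((nat \<Rightarrow> nat) \<Rightarrow> 'k::field) set" where
  "group_ring r = {a. \<forall>p. \<not> p permutes {1..r} \<longrightarrow> a p = 0}"

definition group_ring_mult ::
  "nat \<Rightarrow> ((nat \<Rightarrow> nat) \<Rightarrow> 'k::field) \<Rightarrow> ((nat \<Rightarrow> nat) \<Rightarrow> 'k) \<Rightarrow> (nat \<Rightarrow> nat) \<Rightarrow> 'k" where
  "group_ring_mult r a b = (\<lambda>s.
     \<Sum>(p, q) \<in> {(p, q). p permutes {1..r} \<and> q permutes {1..r} \<and> p \<circ> q = s}. a p * b q)"

definition symmetry_operator ::
  "nat \<Rightarrow> ((nat \<Rightarrow> nat) \<Rightarrow> 'k::field) \<Rightarrow> ((nat \<Rightarrow> 'v) \<Rightarrow> 'k) \<Rightarrow> (nat \<Rightarrow> 'v) \<Rightarrow> 'k" where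
  "symmetry_operator r a T = (\<lambda>v. \<Sum>p | p permutes {1..r}. a p * T (v \<circ> p))"

text \<open>Closure under negation and scalars follows, since they are multiplications by multiples of
  the identity permutation.\<close>

definition right_ideal :: "nat \<Rightarrow> ((nat \<Rightarrow> nat) \<Rightarrow> 'k::field) set \<Rightarrow> bool" where
  "right_ideal r I \<longleftrightarrow> I \<subseteq> group_ring r \<and> 0 \<in> I \<and> (\<forall>a\<in>I. \<forall>b\<in>I. a + b \<in> I) \<and>
     (\<forall>a\<in>I. \<forall>b\<in>group_ring r. group_ring_mult r a b \<in> I)"

definition two_sided_ideal :: "nat \<Rightarrow> ((nat \<Rightarrow> nat) \<Rightarrow> 'k::field) set \<Rightarrow> bool" where
  "two_sided_ideal r I \<longleftrightarrow> right_ideal r I \<and>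
     (\<forall>a\<in>I. \<forall>b\<in>group_ring r. group_ring_mult r b a \<in> I)"

definition minimal_right_ideal :: "nat \<Rightarrow> ((nat \<Rightarrow> nat) \<Rightarrow> 'k::field) set \<Rightarrow> bool" where
  "minimal_right_ideal r I \<longleftrightarrow> right_ideal r I \<and> I \<noteq> {0} \<and>
     (\<forall>J. right_ideal r J \<and> J \<subseteq> I \<longrightarrow> J = {0} \<or> J = I)"

definition minimal_two_sided_ideal :: "nat \<Rightarrow> ((nat \<Rightarrow> nat) \<Rightarrow> 'k::field) set \<Rightarrow> bool" where
  "minimal_two_sided_ideal r I \<longleftrightarrow> two_sided_ideal r I \<and> I \<noteq> {0} \<and>
     (\<forall>J. two_sided_ideal r J \<and> J \<subseteq> I \<longrightarrow> J = {0} \<or> J = I)"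

section \<open>Young symmetrizers and partitions\<close>

definition partition_of :: "nat \<Rightarrow> nat list \<Rightarrow> bool" where
  "partition_of r lam \<longleftrightarrow> sorted_wrt (\<ge>) lam \<and> 0 \<notin> set lam \<and> sum_list lam = r"

text \<open>A tableau is the list of its rows.\<close>

definition young_tableau :: "nat \<Rightarrow> nat list \<Rightarrow> nat list list \<Rightarrow> bool" where
  "young_tableau r lam t \<longleftrightarrow>
     map length t = lam \<and> distinct (concat t) \<and> set (concat t) = {1..r}"

definition tableau_column :: "nat list list \<Rightarrow> nat \<Rightarrow> nat set" where
  "tableau_column t j = {row ! j | row. row \<in> set t \<and> j < length row}"

definition row_permutations :: "nat \<Rightarrow> nat list list \<Rightarrow> (nat \<Rightarrow> nat) set" where
  "row_permutations r t = {p. p permutes {1..r} \<and> (\<forall>row\<in>set t. p ` set row = set row)}"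

definition column_permutations :: "nat \<Rightarrow> nat list list \<Rightarrow> (nat \<Rightarrow> nat) set" where
  "column_permutations r t =
     {q. q permutes {1..r} \<and> (\<forall>j. q ` tableau_column t j = tableau_column t j)}"

definition young_symmetrizer :: "nat \<Rightarrow> nat list list \<Rightarrow> (nat \<Rightarrow> nat) \<Rightarrow> 'k::field" where
  "young_symmetrizer r t = (\<lambda>s.
     \<Sum>(p, q) \<in> {(p, q). p \<in> row_permutations r t \<and> q \<in> column_permutations r t \<and> p \<circ> q = s}.
       of_int (sign q))"

section \<open>Symmetry classes\<close>

definition symmetry_class ::
  "('k::field \<Rightarrow> 'v::ab_group_add \<Rightarrow> 'v) \<Rightarrow> nat \<Rightarrow> ((nat \<Rightarrow> nat) \<Rightarrow> 'k) set
     \<Rightarrow> ((nat \<Rightarrow> 'v) \<Rightarrow> 'k) set" where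
  "symmetry_class sc r I = {symmetry_operator r a T | a T. a \<in> I \<and> T \<in> tensors sc r}"

text \<open>Minimal right ideals which define a symmetry class, i.e. which do not annihilate all tensors
  of order \<open>r\<close> (as may happen if \<open>dim V < r\<close>).\<close>

definition defines_irreducible_class ::
  "('k::field \<Rightarrow> 'v::ab_group_add \<Rightarrow> 'v) \<Rightarrow> nat \<Rightarrow> ((nat \<Rightarrow> nat) \<Rightarrow> 'k) set \<Rightarrow> bool" where
  "defines_irreducible_class sc r I \<longleftrightarrow> minimal_right_ideal r I \<and>
     (\<exists>a\<in>I. \<exists>T\<in>tensors sc r. symmetry_operator r a T \<noteq> 0)"

text \<open>A symmetry class belongs to \<open>lam\<close> through the right ideal \<open>I\<close> which defines it.\<close>

definition belongs_to :: "nat \<Rightarrow> ((nat \<Rightarrow> nat) \<Rightarrow> 'k::field) set \<Rightarrow> nat list \<Rightarrow> bool" where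
  "belongs_to r I lam \<longleftrightarrow> partition_of r lam \<and>
     (\<exists>Z. minimal_two_sided_ideal r Z \<and>
          (\<forall>t. young_tableau r lam t \<longrightarrow> young_symmetrizer r t \<in> Z) \<and> I \<subseteq> Z)"

section \<open>The generator problem\<close>

text \<open>A solution consists of a symmetry operator \<open>a\<close> and a set \<open>P\<close> of product tensors, taken from
  arbitrary irreducible symmetry classes and in either order of the factors, such that the tensors
  \<open>aT\<close> with \<open>T \<in> P\<close> generate the space in question.\<close>

definition curvature_generator_solution ::
  "('k::field \<Rightarrow> 'v::ab_group_add \<Rightarrow> 'v) \<Rightarrow> ((nat \<Rightarrow> nat) \<Rightarrow> 'k)
     \<Rightarrow> ((nat \<Rightarrow> 'v) \<Rightarrow> 'k) set \<Rightarrow> bool" where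
  "curvature_generator_solution sc a P \<longleftrightarrow> a \<in> group_ring 4 \<and>
     (\<forall>T\<in>P. \<exists>I U w. defines_irreducible_class sc 3 I \<and>
        U \<in> symmetry_class sc 3 I \<and> w \<in> tensors sc 1 \<and>
        (T = tensor_prod 3 U w \<or> T = tensor_prod 1 w U)) \<and>
     tensor_span (symmetry_operator 4 a ` P) = curvature_tensors sc"

definition derivative_curvature_generator_solution ::
  "('k::field \<Rightarrow> 'v::ab_group_add \<Rightarrow> 'v) \<Rightarrow> ((nat \<Rightarrow> nat) \<Rightarrow> 'k)
     \<Rightarrow> ((nat \<Rightarrow> 'v) \<Rightarrow> 'k) set \<Rightarrow> bool" where
  "derivative_curvature_generator_solution sc a P \<longleftrightarrow> a \<in> group_ring 5 \<and>
     (\<forall>T\<in>P. \<exists>I J U W. defines_irreducible_class sc 3 I \<and> defines_irreducible_class sc 2 J \<and>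
        U \<in> symmetry_class sc 3 I \<and> W \<in> symmetry_class sc 2 J \<and>
        (T = tensor_prod 3 U W \<or> T = tensor_prod 2 W U)) \<and>
     tensor_span (symmetry_operator 5 a ` P) = derivative_curvature_tensors sc"

end

theory Submission
  imports Defs
begin

text \<open>
  Let \<open>R = aT\<close> be a curvature tensor, \<open>T\<close> a product with a factor \<open>U\<close> of order 3. Symmetrizations
  adapted to the frames \<open>(2 2)\<close> and \<open>(3 2)\<close> are injective on \<open>\<A>(V)\<close> and \<open>\<A>'(V)\<close>. If \<open>U\<close> is symmetric
  or skew, then so is every permuted copy of \<open>T\<close> in three of the argument positions, and by the
  pigeonhole principle these meet a row or column of the frame in two positions, so that the
  symmetrization annihilates every permuted copy of \<open>T\<close>, hence \<open>R\<close>. The only exception is the case of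
  a symmetric \<open>U\<close> and a skew \<open>W\<close>, where the exchange of the two pairs of arguments must also be used.

  On the side of the group ring, a minimal right ideal on which one of the linear characters of
  \<open>S\<^sub>r\<close> (trivial or sign) does not vanish is the line spanned by that character; for \<open>r = 3\<close> all the
  others lie in the common kernel of both characters, which is the minimal two-sided ideal of \<open>(2 1)\<close>.
\<close>

declare One_nat_def [simp del]

section \<open>Symmetries of tensors under transpositions of arguments\<close>

definition order_at_most :: "nat \<Rightarrow> ((nat \<Rightarrow> 'v) \<Rightarrow> 'k) \<Rightarrow> bool" where
  "order_at_most r F \<longleftrightarrow> (\<forall>v w. (\<forall>i\<in>{1..r}. v i = w i) \<longrightarrow> F v = F w)"

text \<open>\<open>e = 1\<close> is symmetry, \<open>e = - 1\<close> skew symmetry. The set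
  \<open>A\<close> of positions is a parameter because a permuted copy of a product holds its
  factors at other positions.\<close>

definition transposition_eigen ::
  "'k::field \<Rightarrow> nat set \<Rightarrow> ((nat \<Rightarrow> 'v) \<Rightarrow> 'k) \<Rightarrow> bool" where
  "transposition_eigen e A F \<longleftrightarrow>
     (\<forall>i\<in>A. \<forall>j\<in>A. i \<noteq> j \<longrightarrow> (\<forall>v. F (v \<circ> transpose i j) = e * F v))"

lemma order_at_mostD:
  "\<lbrakk>order_at_most r F; \<And>i. i \<in> {1..r} \<Longrightarrow> v i = w i\<rbrakk> \<Longrightarrow> F v = F w"
  by (auto simp: order_at_most_def)

lemma transposition_eigenD:
  "\<lbrakk>transposition_eigen e A F; i \<in> A; j \<in> A; i \<noteq> j\<rbrakk> \<Longrightarrow> F (v \<circ> transpose i j) = e * F v"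
  by (auto simp: transposition_eigen_def)

lemma order_at_most_tensors: "T \<in> tensors sc r \<Longrightarrow> order_at_most r T"
  by (auto simp: tensors_def order_at_most_def)

lemma order_at_most_permute:
  assumes "order_at_most r T" "p permutes {1..r}"
  shows "order_at_most r (\<lambda>v. T (v \<circ> p))"
  unfolding order_at_most_def
proof (intro allI impI)
  fix v w :: "nat \<Rightarrow> 'a" assume vw: "\<forall>i\<in>{1..r}. v i = w i"
  show "T (v \<circ> p) = T (w \<circ> p)"
    by (rule order_at_mostD[OF assms(1)]) (use vw permutes_in_image[OF assms(2)] in force)
qed

lemma order_at_most_symmetry_operator:
  assumes "order_at_most r T"
  shows "order_at_most r (symmetry_operator r a T)"
  unfolding order_at_most_def symmetry_operator_def
proof (intro allI impI sum.cong refl)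
  fix v w :: "nat \<Rightarrow> 'a" and p
  assume vw: "\<forall>i\<in>{1..r}. v i = w i" and p: "p \<in> {p. p permutes {1..r}}"
  then show "a p * T (v \<circ> p) = a p * T (w \<circ> p)"
    using order_at_most_permute[OF assms, of p] by (auto simp: order_at_most_def)
qed

lemma order_at_most_symmetry_class: "U \<in> symmetry_class sc r I \<Longrightarrow> order_at_most r U"
  by (auto simp: symmetry_class_def intro: order_at_most_symmetry_operator order_at_most_tensors)

lemma order_at_most_tensor_prod:
  assumes "order_at_most m U" "order_at_most n W"
  shows "order_at_most (m + n) (tensor_prod m U W)"
  unfolding order_at_most_def tensor_prod_def
proof (intro allI impI)
  fix v w :: "nat \<Rightarrow> 'a" assume vw: "\<forall>i\<in>{1..m + n}. v i = w i"
  have "U v = U w" by (rule order_at_mostD[OF assms(1)]) (use vw in auto)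
  moreover have "W (\<lambda>i. v (m + i)) = W (\<lambda>i. w (m + i))"
    by (rule order_at_mostD[OF assms(2)]) (use vw in auto)
  ultimately show "U v * W (\<lambda>i. v (m + i)) = U w * W (\<lambda>i. w (m + i))" by simp
qed

text \<open>For injective \<open>p\<close>, \<open>transpose (p i) (p j) \<circ> p\<close> equals
  \<open>p \<circ> transpose i j\<close>.\<close>

lemma transposition_eigen_permute:
  fixes T :: "(nat \<Rightarrow> 'v) \<Rightarrow> 'k::field"
  assumes "transposition_eigen e A T" "inj p"
  shows "transposition_eigen e (p ` A) (\<lambda>v. T (v \<circ> p))"
  unfolding transposition_eigen_def
proof clarify
  fix i j and v :: "nat \<Rightarrow> 'v" assume ij: "i \<in> A" "j \<in> A" "p i \<noteq> p j"
  have "v \<circ> transpose (p i) (p j) \<circ> p = v \<circ> p \<circ> transpose i j"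
    using assms(2) by (auto simp: fun_eq_iff transpose_def inj_eq)
  then show "T (v \<circ> transpose (p i) (p j) \<circ> p) = e * T (v \<circ> p)"
    using transposition_eigenD[OF assms(1) ij(1,2)] ij(3) by metis
qed

lemma transposition_eigen_tensor_prod_left:
  fixes U W :: "(nat \<Rightarrow> 'v) \<Rightarrow> 'k::field"
  assumes "transposition_eigen e {1..m} U" "order_at_most n W"
  shows "transposition_eigen e {1..m} (tensor_prod m U W)"
  unfolding transposition_eigen_def tensor_prod_def
proof (intro ballI allI impI)
  fix i j :: nat and v
  assume ij: "i \<in> {1..m}" "j \<in> {1..m}" "i \<noteq> j"
  have "U (v \<circ> transpose i j) = e * U v" by (rule transposition_eigenD[OF assms(1) ij])
  moreover have "W (\<lambda>k. (v \<circ> transpose i j) (m + k)) = W (\<lambda>k. v (m + k))"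
    by (rule order_at_mostD[OF assms(2)]) (use ij in \<open>auto simp: transpose_def\<close>)
  ultimately show "U (v \<circ> transpose i j) * W (\<lambda>k. (v \<circ> transpose i j) (m + k))
      = e * (U v * W (\<lambda>k. v (m + k)))"
    by (simp add: mult.assoc)
qed

lemma transposition_eigen_tensor_prod_right:
  fixes U W :: "(nat \<Rightarrow> 'v) \<Rightarrow> 'k::field"
  assumes "order_at_most m U" "transposition_eigen e {1..n} W"
  shows "transposition_eigen e {m + 1..m + n} (tensor_prod m U W)"
  unfolding transposition_eigen_def tensor_prod_def
proof (intro ballI allI impI)
  fix i j :: nat and v
  assume ij: "i \<in> {m + 1..m + n}" "j \<in> {m + 1..m + n}" "i \<noteq> j"
  have "U (v \<circ> transpose i j) = U v"
    by (rule order_at_mostD[OF assms(1)]) (use ij in \<open>auto simp: transpose_def\<close>)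
  moreover have "(\<lambda>k. (v \<circ> transpose i j) (m + k)) = (\<lambda>k. v (m + k)) \<circ> transpose (i - m) (j - m)"
    using ij by (auto simp: fun_eq_iff transpose_def)
  moreover have "W ((\<lambda>k. v (m + k)) \<circ> transpose (i - m) (j - m)) = e * W (\<lambda>k. v (m + k))"
    by (rule transposition_eigenD[OF assms(2)]) (use ij in auto)
  ultimately show "U (v \<circ> transpose i j) * W (\<lambda>k. (v \<circ> transpose i j) (m + k))
      = e * (U v * W (\<lambda>k. v (m + k)))"
    by simp
qed

text \<open>Pigeonhole principle: a permutation keeps the cardinality of \<open>A\<close>, and
  disjoint subsets of \<open>{1..n}\<close> have at most \<open>n\<close> elements together.\<close>

lemma permuted_image_meets:
  assumes "p permutes {1..n}" "A \<subseteq> {1..n}" "Y \<subseteq> {1..n}" "n < card A + card Y"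
  shows "p ` A \<inter> Y \<noteq> {}"
proof
  assume disjoint: "p ` A \<inter> Y = {}"
  have subset: "p ` A \<union> Y \<subseteq> {1..n}"
    using assms(2,3) permutes_in_image[OF assms(1)] by blast
  have "card A + card Y = card (p ` A \<union> Y)"
    using card_Un_disjoint[OF _ _ disjoint] finite_subset[OF subset] permutes_inj_on[OF assms(1)]
    by (simp add: card_image)
  also have "\<dots> \<le> n" using card_mono[OF _ subset] by simp
  finally show False using assms(4) by simp
qed

section \<open>Curvature tensors obtained from products\<close>

lemma curvature_tensors_eq_0I:
  assumes "R \<in> tensors sc 4" "\<And>w x y z. R (args [w, x, y, z]) = 0"
  shows "R = 0"
proof
  fix v
  have "{1..4} = {1, 2, 3, 4::nat}" by auto
  then have "R v = R (args [v 1, v 2, v 3, v 4])"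
    by (intro order_at_mostD[OF order_at_most_tensors[OF assms(1)]]) (auto simp: args_def)
  then show "R v = 0 v" using assms(2) by simp
qed

lemma derivative_curvature_tensors_eq_0I:
  assumes "R \<in> tensors sc 5" "\<And>w x y z u. R (args [w, x, y, z, u]) = 0"
  shows "R = 0"
proof
  fix v
  have "{1..5} = {1, 2, 3, 4, 5::nat}" by auto
  then have "R v = R (args [v 1, v 2, v 3, v 4, v 5])"
    by (intro order_at_mostD[OF order_at_most_tensors[OF assms(1)]]) (auto simp: args_def)
  then show "R v = 0 v" using assms(2) by simp
qed

text \<open>A form of \<open>transposition_eigen_permute\<close> for explicit argument lists: with
  numerals for \<open>i\<close> and \<open>j\<close> the list update evaluates. Positions count from
  1 and list entries from 0, whence \<open>i - 1\<close> and \<open>j - 1\<close>.\<close>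

lemma permuted_transposition_eigen_args:
  assumes T: "order_at_most n T" "transposition_eigen e A T"
    and p: "p permutes {1..n}" and ij: "i \<in> p ` A" "j \<in> p ` A" "i \<noteq> j"
    and A: "A \<subseteq> {1..n}" and xs: "length xs = n"
  shows "T (args (xs[i - 1 := xs ! (j - 1), j - 1 := xs ! (i - 1)]) \<circ> p) = e * T (args xs \<circ> p)"
proof -
  have range: "i \<in> {1..n}" "j \<in> {1..n}"
    using ij A permutes_in_image[OF p] by blast+
  \<comment> \<open>Since \<open>0 - 1 = 0\<close>, \<open>args\<close> repeats the first entry at
    position 0, so the two argument functions need agree only on \<open>{1..n}\<close>.\<close>
  have "T (args (xs[i - 1 := xs ! (j - 1), j - 1 := xs ! (i - 1)]) \<circ> p)
      = T (args xs \<circ> transpose i j \<circ> p)"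
    by (rule order_at_mostD[OF order_at_most_permute[OF T(1) p]])
       (use xs range in \<open>auto simp: args_def transpose_def nth_list_update\<close>)
  also have "\<dots> = e * T (args xs \<circ> p)"
    by (rule transposition_eigenD[OF transposition_eigen_permute[OF T(2) permutes_inj[OF p]] ij])
  finally show ?thesis .
qed

section \<open>Products of order 4 and algebraic curvature tensors\<close>

text \<open>The transpositions of positions 1 2, 3 4 and 1 3 generate all permutations of four
  positions, so \<open>g\<close> is totally alternating. The terms of the Bianchi identity differ by
  3-cycles, which are even, so their sum is three times \<open>g\<close>.\<close>

lemma curvature_symmetries_alternating_eq_0:
  fixes g :: "'v \<Rightarrow> 'v \<Rightarrow> 'v \<Rightarrow> 'v \<Rightarrow> 'k::field_char_0"
  assumes skew: "\<And>w x y z. g w x z y = - g w x y z"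
    and skew': "\<And>w x y z. g x w y z = - g w x y z"
    and bianchi: "\<And>w x y z. g w x y z + g w y z x + g w z x y = 0"
    and alternating: "\<And>w x y z. g y x w z = - g w x y z"
  shows "g w x y z = 0"
proof -
  have swap: "g w y x z = - g w x y z" for w x y z
    using skew'[of w y x z] alternating[of y w x z] skew'[of x w y z] by simp
  have "g w y z x = g w x y z" "g w z x y = g w x y z"
    using skew[of w y x z] swap[of w y x z] swap[of w z x y] skew[of w x y z] by simp_all
  then have "3 * g w x y z = 0" using bianchi[of w x y z] by simp
  then show ?thesis by simp
qed

text \<open>The frame (2 2) is filled with columns {1, 2}, {3, 4} and rows {1, 3}, {2, 4}. For
  \<open>e = 1\<close> the alternating sum over the columns, for \<open>e = - 1\<close> the sum over
  the rows annihilates every permuted copy of \<open>T\<close> and hence \<open>g\<close>.\<close>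

lemma curvature_from_product_eq_0:
  fixes T :: "(nat \<Rightarrow> 'v::ab_group_add) \<Rightarrow> 'k::field_char_0"
  assumes R: "symmetry_operator 4 a T \<in> curvature_tensors sc"
    and T: "order_at_most 4 T" "transposition_eigen e A T" "e = 1 \<or> e = - 1"
    and A: "A \<subseteq> {1..4}" "card A = 3"
  shows "symmetry_operator 4 a T = 0"
proof (rule curvature_tensors_eq_0I)
  show "symmetry_operator 4 a T \<in> tensors sc 4"
    using R by (simp add: curvature_tensors_def)
  define g where "g = (\<lambda>w x y z. symmetry_operator 4 a T (args [w, x, y, z]))"
  define f where "f = (\<lambda>p w x y z. T (args [w, x, y, z] \<circ> p))"
  have g_sum: "g w x y z = (\<Sum>p | p permutes {1..4}. a p * f p w x y z)" for w x y z
    by (simp add: g_def f_def symmetry_operator_def)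
  have skew: "g w x z y = - g w x y z"
    and pair: "g y z w x = g w x y z"
    and bianchi: "g w x y z + g w y z x + g w z x y = 0" for w x y z
    using R unfolding curvature_tensors_def g_def mem_Collect_eq by (metis minus_minus)+
  have skew': "g x w y z = - g w x y z" for w x y z
    using pair[of x w y z] pair[of w x y z] skew[of y z w x] by simp
  \<comment> \<open>The image of \<open>A\<close> under \<open>p\<close> misses only one of the four
    positions.\<close>
  have meets: "x \<in> p ` A \<or> y \<in> p ` A"
    if "p permutes {1..4}" "x \<in> {1..4}" "y \<in> {1..4}" "x \<noteq> y" for p x y
    using permuted_image_meets[OF that(1) A(1), of "{x, y}"] that A(2) by auto
  have swap: "f p x w y z = e * f p w x y z" if "p permutes {1..4}" "1 \<in> p ` A" "2 \<in> p ` A" for p w x y z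
    using permuted_transposition_eigen_args[OF T(1,2) that _ A(1), of "[w, x, y, z]"]
    by (simp add: f_def numeral_eq_Suc)
  have swap34: "f p w x z y = e * f p w x y z" if "p permutes {1..4}" "3 \<in> p ` A" "4 \<in> p ` A" for p w x y z
    using permuted_transposition_eigen_args[OF T(1,2) that _ A(1), of "[w, x, y, z]"]
    by (simp add: f_def numeral_eq_Suc)
  have swap13: "f p y x w z = e * f p w x y z" if "p permutes {1..4}" "1 \<in> p ` A" "3 \<in> p ` A" for p w x y z
    using permuted_transposition_eigen_args[OF T(1,2) that _ A(1), of "[w, x, y, z]"]
    by (simp add: f_def numeral_eq_Suc)
  have swap24: "f p w z y x = e * f p w x y z" if "p permutes {1..4}" "2 \<in> p ` A" "4 \<in> p ` A" for p w x y z
    using permuted_transposition_eigen_args[OF T(1,2) that _ A(1), of "[w, x, y, z]"]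
    by (simp add: f_def numeral_eq_Suc)
  show "symmetry_operator 4 a T (args [w, x, y, z]) = 0" for w x y z
  proof (cases "e = 1")
    case True
    have "f p w x y z - f p x w y z - f p w x z y + f p x w z y = 0" if p: "p permutes {1..4}" for p
    proof -
      \<comment> \<open>If the image of \<open>A\<close> contained neither column, it would miss a
        position of each; the instances of \<open>meets\<close> run through these four
        pairs.\<close>
      have "1 \<in> p ` A \<and> 2 \<in> p ` A \<or> 3 \<in> p ` A \<and> 4 \<in> p ` A"
        using meets[OF p, of 1 3] meets[OF p, of 1 4] meets[OF p, of 2 3] meets[OF p, of 2 4] by auto
      then show ?thesis
        using swap[OF p, of x w] swap34[OF p, of _ _ z y] True by auto
    qed
    then have "(\<Sum>p | p permutes {1..4}. a p * (f p w x y z - f p x w y z - f p w x z y + f p x w z y)) = 0"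
      by simp
    then have "g w x y z - g x w y z - g w x z y + g x w z y = 0"
      by (simp add: g_sum sum.distrib sum_subtractf algebra_simps)
    then have "4 * g w x y z = 0"
      using skew[of w x z y] skew[of x w z y] skew'[of x w y z] by (simp add: algebra_simps)
    then show ?thesis by (simp add: g_def)
  next
    case False
    then have e: "e = - 1" using T(3) by simp
    have alternating: "g y x w z = - g w x y z" for w x y z
    proof -
      have "f p w x y z + f p y x w z + f p w z y x + f p y z w x = 0" if p: "p permutes {1..4}" for p
      proof -
        have "1 \<in> p ` A \<and> 3 \<in> p ` A \<or> 2 \<in> p ` A \<and> 4 \<in> p ` A"
          using meets[OF p, of 1 2] meets[OF p, of 1 4] meets[OF p, of 3 2] meets[OF p, of 3 4] by auto
        then show ?thesis
          using swap13[OF p, of y _ w] swap24[OF p, of _ x _ z] e by auto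
      qed
      then have "(\<Sum>p | p permutes {1..4}. a p * (f p w x y z + f p y x w z + f p w z y x + f p y z w x)) = 0"
        by simp
      then have "g w x y z + g y x w z + g w z y x + g y z w x = 0"
        by (simp add: g_sum sum.distrib algebra_simps)
      \<comment> \<open>The pair exchange acts as the transpositions 1 3 and 2 4 together, so the
        four terms agree two by two.\<close>
      then have "2 * (g w x y z + g y x w z) = 0"
        using pair[of w x y z] pair[of y x w z] by (simp add: algebra_simps)
      then have "g w x y z + g y x w z = 0" unfolding mult_eq_0_iff by simp
      then show ?thesis by (simp add: eq_neg_iff_add_eq_0 add.commute)
    qed
    show ?thesis
      using curvature_symmetries_alternating_eq_0[of g, OF skew skew' bianchi alternating]
      by (simp add: g_def)
  qed
qed

section \<open>Products of order 5 and algebraic covariant derivative curvature tensors\<close>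

text \<open>\<open>rows\<close> is the row symmetrization for the frame (3 2) with rows {1, 3, 5}
  and {2, 4}. The second Bianchi identity converts it into skew symmetry in positions 1 and 3, which
  leads to the totally alternating case.\<close>

lemma derivative_curvature_row_sums_eq_0:
  fixes g :: "'v \<Rightarrow> 'v \<Rightarrow> 'v \<Rightarrow> 'v \<Rightarrow> 'v \<Rightarrow> 'k::field_char_0"
  assumes skew: "\<And>w x y z u. g w x z y u = - g w x y z u"
    and pair: "\<And>w x y z u. g y z w x u = g w x y z u"
    and bianchi1: "\<And>w x y z u. g w x y z u + g w y z x u + g w z x y u = 0"
    and bianchi2: "\<And>w x y z u. g w x y z u + g w x z u y + g w x u y z = 0"
    and rows: "\<And>w x y z u.
      g w x y z u + g y x w z u + g w x u z y + g u x w z y + g y x u z w + g u x y z w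
      + g w z y x u + g y z w x u + g w z u x y + g u z w x y + g y z u x w + g u z y x w = 0"
  shows "g w x y z u = 0"
proof -
  have skew': "g x w y z u = - g w x y z u" for w x y z u
    using pair[of x w y z u] pair[of w x y z u] skew[of y z w x u] by simp
  \<comment> \<open>The seven nontrivial elements of the dihedral group of order 8 generated by the
    skew symmetries and the pair exchange.\<close>
  have forms: "g w x y z u = - g x w y z u" "g w x y z u = - g w x z y u" "g w x y z u = g x w z y u"
    "g w x y z u = g y z w x u" "g w x y z u = - g z y w x u" "g w x y z u = - g y z x w u"
    "g w x y z u = g z y x w u" for w x y z u
    using skew'[of w x y z u] skew[of w x y z u] skew'[of w x z y u] pair[of w x y z u]
      pair[of w x z y u] pair[of x w y z u] pair[of x w z y u] by simp_all
  have rows': "g w x y z u + g y x w z u + g w x u z y + g u x w z y + g y x u z w + g u x y z w = 0"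
    for w x y z u
  proof -
    \<comment> \<open>The pair exchange identifies the last six terms of \<open>rows\<close> with
      the first six.\<close>
    have "2 * (g w x y z u + g y x w z u + g w x u z y + g u x w z y + g y x u z w + g u x y z w) = 0"
      using rows[of w x y z u] pair[of w x y z u] pair[of y x w z u] pair[of w x u z y]
        pair[of u x w z y] pair[of y x u z w] pair[of u x y z w] by (simp add: algebra_simps)
    then show ?thesis unfolding mult_eq_0_iff by simp
  qed
  have alternating: "g y x w z u = - g w x y z u" for w x y z u
  proof -
    \<comment> \<open>In the row sums for \<open>w\<close>, \<open>y\<close>, \<open>u\<close> and
      for \<open>x\<close>, \<open>z\<close>, \<open>u\<close> the terms ending in \<open>u\<close>
      give two copies of \<open>g w x y z u + g y x w z u\<close>. Four instances of
      \<open>bianchi2\<close> turn the eight other terms into two more copies.\<close>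
    have "4 * (g w x y z u + g y x w z u) = 0"
      using rows'[of x w z y u] rows'[of w x y z u] bianchi2[of w x y z u] bianchi2[of y z w x u]
        bianchi2[of x y w z u] bianchi2[of w z x y u]
        forms(3)[of w x y z u] forms(1)[of w z x y u] forms(3)[of w x y u z] forms(1)[of w u x y z]
        forms(3)[of w z y u x] forms(3)[of w u y z x] forms(5)[of w z x y u] forms(2)[of w x z u y]
        forms(5)[of w z x u y] forms(3)[of x y z u w] forms(1)[of x u y z w] forms(2)[of w x y u z]
        forms(4)[of w x y z u] forms(4)[of x u y z w] forms(6)[of w u y z x] forms(4)[of w z x y u]
        forms(6)[of w u x y z] forms(2)[of w z x u y]
      by algebra
    then have "g w x y z u + g y x w z u = 0" unfolding mult_eq_0_iff by simp
    then show ?thesis by (simp add: eq_neg_iff_add_eq_0 add.commute)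
  qed
  show ?thesis
    using curvature_symmetries_alternating_eq_0[of "\<lambda>w x y z. g w x y z u", OF skew skew' bianchi1 alternating] .
qed

text \<open>\<open>A\<close> stands for the positions of the factor of order 3 in \<open>T\<close>,
  its complement for those of the factor of order 2.\<close>

locale derivative_curvature_product =
  fixes sc :: "'k::field_char_0 \<Rightarrow> 'v::ab_group_add \<Rightarrow> 'v" and a :: "(nat \<Rightarrow> nat) \<Rightarrow> 'k"
    and T :: "(nat \<Rightarrow> 'v) \<Rightarrow> 'k" and A :: "nat set"
  assumes R: "symmetry_operator 5 a T \<in> derivative_curvature_tensors sc"
    and T: "order_at_most 5 T"
    and A: "A \<subseteq> {1..5}" "card A = 3"
begin

definition g where "g = (\<lambda>w x y z u. symmetry_operator 5 a T (args [w, x, y, z, u]))"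

text \<open>The contribution of \<open>p\<close> to \<open>g\<close>: a linear relation valid for
  every \<open>f p\<close> passes to \<open>g\<close> by summation.\<close>

definition f where "f = (\<lambda>p w x y z u. T (args [w, x, y, z, u] \<circ> p))"

lemma g_sum: "g w x y z u = (\<Sum>p | p permutes {1..5}. a p * f p w x y z u)"
  by (simp add: g_def f_def symmetry_operator_def)

lemma g_symmetries:
  "g w x z y u = - g w x y z u" "g y z w x u = g w x y z u" "g x w y z u = - g w x y z u"
  "g w x y z u + g w y z x u + g w z x y u = 0"
  "g w x y z u + g w x z u y + g w x u y z = 0"
proof -
  have skew: "g w x z y u = - g w x y z u" and pair: "g y z w x u = g w x y z u" for w x y z u
    using R unfolding derivative_curvature_tensors_def g_def mem_Collect_eq by (metis minus_minus)+
  show "g w x z y u = - g w x y z u" "g y z w x u = g w x y z u" by (rule skew pair)+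
  show "g x w y z u = - g w x y z u"
    using pair[of x w y z u] pair[of w x y z u] skew[of y z w x u] by simp
  show "g w x y z u + g w y z x u + g w z x y u = 0"
    "g w x y z u + g w x z u y + g w x u y z = 0"
    using R unfolding derivative_curvature_tensors_def g_def mem_Collect_eq by metis+
qed

lemma eq_0I: "(\<And>w x y z u. g w x y z u = 0) \<Longrightarrow> symmetry_operator 5 a T = 0"
  using R by (intro derivative_curvature_tensors_eq_0I)
    (auto simp: derivative_curvature_tensors_def g_def)

lemma meets:
  assumes "p permutes {1..5}" "x \<in> {1..5}" "y \<in> {1..5}" "z \<in> {1..5}" "x \<noteq> y" "x \<noteq> z" "y \<noteq> z"
  shows "x \<in> p ` A \<or> y \<in> p ` A \<or> z \<in> p ` A"
  using permuted_image_meets[OF assms(1) A(1), of "{x, y, z}"] assms A(2) by auto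

text \<open>\<open>B\<close> will be \<open>A\<close> or its complement; the eight transpositions
  are those that the case distinctions below need.\<close>

lemma swap:
  assumes e: "transposition_eigen e B T" "B \<subseteq> {1..5}" and p: "p permutes {1..5}"
  shows "1 \<in> p ` B \<Longrightarrow> 2 \<in> p ` B \<Longrightarrow> f p x w y z u = e * f p w x y z u"
    "1 \<in> p ` B \<Longrightarrow> 3 \<in> p ` B \<Longrightarrow> f p y x w z u = e * f p w x y z u"
    "1 \<in> p ` B \<Longrightarrow> 4 \<in> p ` B \<Longrightarrow> f p z x y w u = e * f p w x y z u"
    "1 \<in> p ` B \<Longrightarrow> 5 \<in> p ` B \<Longrightarrow> f p u x y z w = e * f p w x y z u"
    "2 \<in> p ` B \<Longrightarrow> 3 \<in> p ` B \<Longrightarrow> f p w y x z u = e * f p w x y z u"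
    "2 \<in> p ` B \<Longrightarrow> 4 \<in> p ` B \<Longrightarrow> f p w z y x u = e * f p w x y z u"
    "3 \<in> p ` B \<Longrightarrow> 4 \<in> p ` B \<Longrightarrow> f p w x z y u = e * f p w x y z u"
    "3 \<in> p ` B \<Longrightarrow> 5 \<in> p ` B \<Longrightarrow> f p w x u z y = e * f p w x y z u"
proof -
  note swap = permuted_transposition_eigen_args[OF T e(1) p _ _ _ e(2), of _ _ "[w, x, y, z, u]"]
  show "f p x w y z u = e * f p w x y z u" if "1 \<in> p ` B" "2 \<in> p ` B"
    using swap[OF that] by (simp add: f_def numeral_eq_Suc)
  show "f p y x w z u = e * f p w x y z u" if "1 \<in> p ` B" "3 \<in> p ` B"
    using swap[OF that] by (simp add: f_def numeral_eq_Suc)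
  show "f p z x y w u = e * f p w x y z u" if "1 \<in> p ` B" "4 \<in> p ` B"
    using swap[OF that] by (simp add: f_def numeral_eq_Suc)
  show "f p u x y z w = e * f p w x y z u" if "1 \<in> p ` B" "5 \<in> p ` B"
    using swap[OF that] by (simp add: f_def numeral_eq_Suc)
  show "f p w y x z u = e * f p w x y z u" if "2 \<in> p ` B" "3 \<in> p ` B"
    using swap[OF that] by (simp add: f_def numeral_eq_Suc)
  show "f p w z y x u = e * f p w x y z u" if "2 \<in> p ` B" "4 \<in> p ` B"
    using swap[OF that] by (simp add: f_def numeral_eq_Suc)
  show "f p w x z y u = e * f p w x y z u" if "3 \<in> p ` B" "4 \<in> p ` B"
    using swap[OF that] by (simp add: f_def numeral_eq_Suc)
  show "f p w x u z y = e * f p w x y z u" if "3 \<in> p ` B" "5 \<in> p ` B"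
    using swap[OF that] by (simp add: f_def numeral_eq_Suc)
qed

text \<open>Three positions cannot lie in the rows {1, 3, 5} and {2, 4} with at most one in each. So
  every permuted copy of \<open>T\<close> is skew in two positions of a row, and the sum over the
  twelve row permutations annihilates it.\<close>

lemma skew_eq_0:
  assumes e: "transposition_eigen (- 1) A T"
  shows "symmetry_operator 5 a T = 0"
proof (rule eq_0I, rule derivative_curvature_row_sums_eq_0[of g, OF g_symmetries(1,2,4,5)])
  fix w x y z u
  let ?F = "\<lambda>h :: 'v \<Rightarrow> 'v \<Rightarrow> 'v \<Rightarrow> 'v \<Rightarrow> 'v \<Rightarrow> 'k. h w x y z u + h y x w z u + h w x u z y + h u x w z y + h y x u z w + h u x y z w
      + h w z y x u + h y z w x u + h w z u x y + h u z w x y + h y z u x w + h u z y x w"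
  have "?F (f p) = 0" if p: "p permutes {1..5}" for p
  proof -
    define M where "M = p ` A"
    \<comment> \<open>The triples consist of two positions of the long row and one of the short row.
      If no row had two positions in \<open>M\<close>, one of them would be missed.\<close>
    have m: "1 \<in> M \<or> 3 \<in> M \<or> 2 \<in> M" "1 \<in> M \<or> 3 \<in> M \<or> 4 \<in> M" "1 \<in> M \<or> 5 \<in> M \<or> 2 \<in> M"
      "1 \<in> M \<or> 5 \<in> M \<or> 4 \<in> M" "3 \<in> M \<or> 5 \<in> M \<or> 2 \<in> M" "3 \<in> M \<or> 5 \<in> M \<or> 4 \<in> M"
      unfolding M_def by (rule meets[OF p]; simp)+
    have "1 \<in> M \<and> 3 \<in> M \<or> 1 \<in> M \<and> 5 \<in> M \<or> 3 \<in> M \<and> 5 \<in> M \<or> 2 \<in> M \<and> 4 \<in> M"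
      using m by (cases "1 \<in> M"; cases "3 \<in> M"; cases "5 \<in> M") simp_all
    then show ?thesis
      unfolding M_def
    proof (elim disjE conjE)
      assume "1 \<in> p ` A" "3 \<in> p ` A"
      note s = swap(2)[OF e A(1) p this]
      show ?thesis
        using s[of w x y z u] s[of w x u z y] s[of y x u z w]
          s[of w z y x u] s[of w z u x y] s[of y z u x w] by simp
    next
      assume "1 \<in> p ` A" "5 \<in> p ` A"
      note s = swap(4)[OF e A(1) p this]
      show ?thesis
        using s[of w x y z u] s[of y x w z u] s[of w x u z y]
          s[of w z y x u] s[of y z w x u] s[of w z u x y] by simp
    next
      assume "3 \<in> p ` A" "5 \<in> p ` A"
      note s = swap(8)[OF e A(1) p this]
      show ?thesis
        using s[of w x y z u] s[of y x w z u] s[of u x w z y]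
          s[of w z y x u] s[of y z w x u] s[of u z w x y] by simp
    next
      assume "2 \<in> p ` A" "4 \<in> p ` A"
      note s = swap(6)[OF e A(1) p this]
      show ?thesis
        using s[of w x y z u] s[of y x w z u] s[of w x u z y]
          s[of u x w z y] s[of y x u z w] s[of u x y z w] by simp
    qed
  qed
  then have "(\<Sum>p | p permutes {1..5}. a p * ?F (f p)) = 0" by simp
  then show "?F g = 0"
    by (simp add: g_sum sum.distrib algebra_simps)
qed

text \<open>The alternating sum over the columns {1, 2}, {3, 4}, symmetrized under the pair
  exchange, multiplies \<open>g\<close> by 8. It annihilates a copy that is symmetric in a whole
  column. Otherwise each column has one position of either factor, and the skew factor changes the
  sign under an exchange of the pairs.\<close>

lemma symmetric_skew_eq_0:
  assumes e: "transposition_eigen 1 A T" "transposition_eigen (- 1) ({1..5} - A) T"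
  shows "symmetry_operator 5 a T = 0"
proof (rule eq_0I)
  fix w x y z u
  let ?F = "\<lambda>h :: 'v \<Rightarrow> 'v \<Rightarrow> 'v \<Rightarrow> 'v \<Rightarrow> 'v \<Rightarrow> 'k. h w x y z u - h x w y z u - h w x z y u + h x w z y u
      + h y z w x u - h y z x w u - h z y w x u + h z y x w u"
  have "?F (f p) = 0" if p: "p permutes {1..5}" for p
  proof -
    have compl: "x \<in> p ` ({1..5} - A)" if "x \<notin> p ` A" "1 \<le> x" "x \<le> 5" for x
    proof -
      have "x \<in> p ` {1..5}" using that by (simp add: permutes_image[OF p])
      then show ?thesis using that(1) by blast
    qed
    note sym = swap[OF e(1) A(1) p] and skew = swap[OF e(2) Diff_subset p]
    define M where "M = p ` A"
    have m: "1 \<in> M \<or> 3 \<in> M \<or> 2 \<in> M" "1 \<in> M \<or> 3 \<in> M \<or> 4 \<in> M"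
      "1 \<in> M \<or> 4 \<in> M \<or> 2 \<in> M" "2 \<in> M \<or> 3 \<in> M \<or> 4 \<in> M"
      unfolding M_def by (rule meets[OF p]; simp)+
    \<comment> \<open>Only two positions are missed, so either a column lies in \<open>M\<close> or
      exactly one position of each column does.\<close>
    consider "1 \<in> M" "2 \<in> M" | "3 \<in> M" "4 \<in> M"
      | "1 \<in> M" "3 \<in> M" "2 \<notin> M" "4 \<notin> M"
      | "2 \<in> M" "4 \<in> M" "1 \<notin> M" "3 \<notin> M"
      | "1 \<in> M" "4 \<in> M" "2 \<notin> M" "3 \<notin> M"
      | "2 \<in> M" "3 \<in> M" "1 \<notin> M" "4 \<notin> M"
      using m by (cases "1 \<in> M"; cases "2 \<in> M"; cases "3 \<in> M"; cases "4 \<in> M") simp_all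
    then show ?thesis
      unfolding M_def
    proof cases
      case 1
      have "f p x w y z u = f p w x y z u" for w x y z using sym(1)[OF 1, of x w y z u] by simp
      then show ?thesis by simp
    next
      case 2
      have "f p w x z y u = f p w x y z u" for w x y z using sym(7)[OF 2, of w x z y u] by simp
      then show ?thesis by simp
    next
      case 3
      \<comment> \<open>The transposition 1 3 in the symmetric factor keeps the sign and 2 4 in the
        skew factor changes it; together they exchange the pairs.\<close>
      have s: "f p w x y z u = - f p y z w x u" for w x y z
        using sym(2)[OF 3(1,2), of y z w x u] skew(6)[OF compl[OF 3(3), simplified] compl[OF 3(4), simplified], of w z y x u] by simp
      show ?thesis using s[of w x y z] s[of x w y z] s[of w x z y] s[of x w z y] by simp
    next
      case 4
      have s: "f p w x y z u = - f p y z w x u" for w x y z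
        using sym(6)[OF 4(1,2), of w z y x] skew(2)[OF compl[OF 4(3), simplified] compl[OF 4(4), simplified], of y z w x u] by simp
      show ?thesis using s[of w x y z] s[of x w y z] s[of w x z y] s[of x w z y] by simp
    next
      case 5
      \<comment> \<open>The transpositions 1 4 and 2 3 together are the pair exchange with both
        pairs reversed.\<close>
      have s: "f p w x y z u = - f p z y x w u" for w x y z
        using sym(3)[OF 5(1,2), of z y x w u] skew(5)[OF compl[OF 5(3), simplified] compl[OF 5(4), simplified], of w y x z u] by simp
      show ?thesis using s[of w x y z] s[of x w y z] s[of w x z y] s[of x w z y] by simp
    next
      case 6
      have s: "f p w x y z u = - f p z y x w u" for w x y z
        using sym(5)[OF 6(1,2), of w y x z] skew(3)[OF compl[OF 6(3), simplified] compl[OF 6(4), simplified], of z y x w u] by simp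
      show ?thesis using s[of w x y z] s[of x w y z] s[of w x z y] s[of x w z y] by simp
    qed
  qed
  then have "(\<Sum>p | p permutes {1..5}. a p * ?F (f p)) = 0" by simp
  then have "?F g = 0"
    by (simp add: g_sum sum.distrib sum_subtractf algebra_simps)
  then have "8 * g w x y z u = 0"
    using g_symmetries(1)[of w x y z u] g_symmetries(1)[of x w y z u] g_symmetries(3)[of w x y z u]
      g_symmetries(2)[of w x y z u] g_symmetries(2)[of w x z y u] g_symmetries(2)[of x w y z u]
      g_symmetries(2)[of x w z y u] by algebra
  then show "g w x y z u = 0" by simp
qed

end

section \<open>Linear characters and minimal ideals of the group ring\<close>

lemma permutes_comp:
  "\<lbrakk>p permutes S; q permutes S\<rbrakk> \<Longrightarrow> p \<circ> q permutes S"
  by (rule permutes_compose)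

text \<open>The second clause ranges over all functions; \<open>sign\<close> is 1 or -1 by
  definition even off the permutations.\<close>

definition linear_character :: "nat \<Rightarrow> ((nat \<Rightarrow> nat) \<Rightarrow> 'k::field) \<Rightarrow> bool" where
  "linear_character r \<chi> \<longleftrightarrow>
     (\<forall>p q. p permutes {1..r} \<longrightarrow> q permutes {1..r} \<longrightarrow> \<chi> (p \<circ> q) = \<chi> p * \<chi> q) \<and>
     (\<forall>p. \<chi> p * \<chi> p = 1)"

definition sign_char :: "(nat \<Rightarrow> nat) \<Rightarrow> 'k::field" where
  "sign_char p = of_int (sign p)"

definition char_sum :: "nat \<Rightarrow> ((nat \<Rightarrow> nat) \<Rightarrow> 'k::field) \<Rightarrow> ((nat \<Rightarrow> nat) \<Rightarrow> 'k) \<Rightarrow> 'k" where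
  "char_sum r \<chi> a = (\<Sum>p | p permutes {1..r}. a p * \<chi> p)"

text \<open>The points of the line spanned by the sum of all \<open>\<chi> p\<close> times
  \<open>p\<close>, with \<open>c\<close> as coordinate.\<close>

definition char_elem :: "nat \<Rightarrow> ((nat \<Rightarrow> nat) \<Rightarrow> 'k::field) \<Rightarrow> 'k \<Rightarrow> (nat \<Rightarrow> nat) \<Rightarrow> 'k" where
  "char_elem r \<chi> c = (\<lambda>p. if p permutes {1..r} then c * \<chi> p else 0)"

definition scaled_perm :: "'k::field \<Rightarrow> (nat \<Rightarrow> nat) \<Rightarrow> (nat \<Rightarrow> nat) \<Rightarrow> 'k" where
  "scaled_perm c q = (\<lambda>p. if p = q then c else 0)"

text \<open>The common kernel of the trivial and the sign representation. In characteristic 0 it is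
  zero for \<open>r = 2\<close> and the two-sided ideal of the frame (2 1) for
  \<open>r = 3\<close>.\<close>

definition nonlinear_part :: "nat \<Rightarrow> ((nat \<Rightarrow> nat) \<Rightarrow> 'k::field) set" where
  "nonlinear_part r = {a \<in> group_ring r. char_sum r (\<lambda>_. 1) a = 0 \<and> char_sum r sign_char a = 0}"

lemma linear_character_trivial: "linear_character r (\<lambda>_. 1)"
  by (simp add: linear_character_def)

lemma sign_comp_permutes:
  fixes r :: nat
  assumes "p permutes {1..r}" "q permutes {1..r}"
  shows "sign (p \<circ> q) = sign p * sign q"
  using assms by (intro sign_compose permutes_imp_permutation) auto

lemma linear_character_sign: "linear_character r sign_char"
  by (simp add: linear_character_def sign_char_def sign_comp_permutes flip: of_int_mult)

lemma permutes_inv_comp: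
  "p permutes S \<Longrightarrow> inv p \<circ> (p \<circ> q) = q" "p permutes S \<Longrightarrow> p \<circ> (inv p \<circ> q) = q"
  "p permutes S \<Longrightarrow> (q \<circ> inv p) \<circ> p = q" "p permutes S \<Longrightarrow> (q \<circ> p) \<circ> inv p = q"
  by (simp_all add: fun_eq_iff permutes_inverses)

text \<open>As its values square to 1, \<open>\<chi>\<close> agrees on \<open>p\<close> and
  \<open>inv p\<close>.\<close>

lemma linear_character_inv_comp:
  assumes "linear_character r \<chi>" "p permutes {1..r}" "s permutes {1..r}"
  shows "\<chi> (inv p \<circ> s) = \<chi> p * \<chi> s"
proof -
  have "\<chi> (p \<circ> (inv p \<circ> s)) = \<chi> p * \<chi> (inv p \<circ> s)"
    using assms permutes_comp[OF permutes_inv[OF assms(2)] assms(3)]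
    unfolding linear_character_def by blast
  then have "\<chi> s = \<chi> p * \<chi> (inv p \<circ> s)"
    by (simp add: permutes_inv_comp(2)[OF assms(2)])
  then have "\<chi> p * \<chi> s = (\<chi> p * \<chi> p) * \<chi> (inv p \<circ> s)"
    by (metis mult.assoc)
  moreover have "\<chi> p * \<chi> p = 1" using assms(1) by (simp add: linear_character_def)
  ultimately show ?thesis by simp
qed

section \<open>Multiplication by permutations and by character elements\<close>

lemma group_ring_mult_permutes:
  assumes "s permutes {1..r}"
  shows "group_ring_mult r a b s = (\<Sum>p | p permutes {1..r}. a p * b (inv p \<circ> s))"
  unfolding group_ring_mult_def
  by (rule sum.reindex_bij_witness[where i = "\<lambda>p. (p, inv p \<circ> s)" and j = fst])
     (auto simp: permutes_inv_comp permutes_comp permutes_inv assms)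

lemma group_ring_mult_outside:
  "\<not> s permutes {1..r} \<Longrightarrow> group_ring_mult r a b s = 0"
  unfolding group_ring_mult_def by (rule sum.neutral) (auto simp: permutes_comp)

lemma group_ring_mult_in_group_ring: "group_ring_mult r a b \<in> group_ring r"
  by (simp add: group_ring_def group_ring_mult_outside)

lemma scaled_perm_in_group_ring: "q permutes {1..r} \<Longrightarrow> scaled_perm c q \<in> group_ring r"
  by (auto simp: group_ring_def scaled_perm_def)

lemma char_elem_in_group_ring: "char_elem r \<chi> c \<in> group_ring r"
  by (auto simp: group_ring_def char_elem_def)

lemma finite_permutes: "finite {p. p permutes {1..r::nat}}"
  by (rule finite_permutations) simp

lemma group_ring_mult_scaled_perm_left:
  assumes "q permutes {1..r}" "s permutes {1..r}"
  shows "group_ring_mult r (scaled_perm c q) a s = c * a (inv q \<circ> s)"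
proof -
  have "group_ring_mult r (scaled_perm c q) a s
      = (\<Sum>p | p permutes {1..r}. if p = q then c * a (inv q \<circ> s) else 0)"
    unfolding group_ring_mult_permutes[OF assms(2)] by (rule sum.cong) (auto simp: scaled_perm_def)
  also have "\<dots> = c * a (inv q \<circ> s)" using assms(1) finite_permutes[of r] by simp
  finally show ?thesis .
qed

lemma group_ring_mult_scaled_perm_right:
  assumes "q permutes {1..r}" "s permutes {1..r}"
  shows "group_ring_mult r a (scaled_perm c q) s = a (s \<circ> inv q) * c"
proof -
  have eq: "inv p \<circ> s = q \<longleftrightarrow> p = s \<circ> inv q" if "p permutes {1..r}" for p
    using permutes_inv_comp[OF assms(1)] permutes_inv_comp[OF that]
    by (metis comp_assoc)
  have "group_ring_mult r a (scaled_perm c q) s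
      = (\<Sum>p | p permutes {1..r}. if p = s \<circ> inv q then a (s \<circ> inv q) * c else 0)"
    unfolding group_ring_mult_permutes[OF assms(2)]
    by (rule sum.cong) (auto simp: scaled_perm_def eq)
  also have "\<dots> = a (s \<circ> inv q) * c"
    using permutes_comp[OF assms(2) permutes_inv[OF assms(1)]] finite_permutes[of r] by simp
  finally show ?thesis .
qed

lemma sum_permutes_translate:
  assumes "q permutes {1..r::nat}"
  shows "(\<Sum>p | p permutes {1..r}. F (q \<circ> p)) = (\<Sum>p | p permutes {1..r}. F p)"
    "(\<Sum>p | p permutes {1..r}. F (p \<circ> q)) = (\<Sum>p | p permutes {1..r}. F p)"
proof -
  show "(\<Sum>p | p permutes {1..r}. F (q \<circ> p)) = (\<Sum>p | p permutes {1..r}. F p)"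
    by (rule sum.reindex_bij_witness[where i = "\<lambda>p. inv q \<circ> p" and j = "\<lambda>p. q \<circ> p"])
       (auto simp: permutes_inv_comp[OF assms] permutes_comp permutes_inv assms)
  show "(\<Sum>p | p permutes {1..r}. F (p \<circ> q)) = (\<Sum>p | p permutes {1..r}. F p)"
    by (rule sum.reindex_bij_witness[where i = "\<lambda>p. p \<circ> inv q" and j = "\<lambda>p. p \<circ> q"])
       (auto simp: permutes_inv_comp[OF assms] permutes_comp permutes_inv assms)
qed

lemma sum_permutes_inv_comp:
  assumes "s permutes {1..r::nat}"
  shows "(\<Sum>p | p permutes {1..r}. F (inv p \<circ> s)) = (\<Sum>p | p permutes {1..r}. F p)"
  using sum_permutations_inverse[of "\<lambda>p. F (p \<circ> s)" "{1..r}"] sum_permutes_translate(2)[OF assms, of F]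
  by simp

text \<open>Every translate of a character element is a multiple of it, so \<open>a\<close> acts on
  the line by a scalar.\<close>

lemma group_ring_mult_char_elem_right:
  assumes "linear_character r \<chi>"
  shows "group_ring_mult r a (char_elem r \<chi> c) = char_elem r \<chi> (char_sum r \<chi> a * c)"
proof
  fix s
  show "group_ring_mult r a (char_elem r \<chi> c) s = char_elem r \<chi> (char_sum r \<chi> a * c) s"
  proof (cases "s permutes {1..r}")
    case True
    have "group_ring_mult r a (char_elem r \<chi> c) s
        = (\<Sum>p | p permutes {1..r}. (a p * \<chi> p) * (c * \<chi> s))"
      unfolding group_ring_mult_permutes[OF True]
      by (rule sum.cong)
         (auto simp: char_elem_def linear_character_inv_comp[OF assms _ True]
            permutes_comp[OF permutes_inv True])
    then show ?thesis using True by (simp add: char_elem_def char_sum_def sum_distrib_right mult.assoc)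
  qed (simp add: group_ring_mult_outside char_elem_def)
qed

lemma group_ring_mult_char_elem_left:
  assumes "linear_character r \<chi>"
  shows "group_ring_mult r (char_elem r \<chi> c) a = char_elem r \<chi> (c * char_sum r \<chi> a)"
proof
  fix s
  show "group_ring_mult r (char_elem r \<chi> c) a s = char_elem r \<chi> (c * char_sum r \<chi> a) s"
  proof (cases "s permutes {1..r}")
    case True
    have 1: "\<chi> p = \<chi> (inv p \<circ> s) * \<chi> s" if "p permutes {1..r}" for p
      using linear_character_inv_comp[OF assms that True] assms by (simp add: linear_character_def)
    have "group_ring_mult r (char_elem r \<chi> c) a s
        = (\<Sum>p | p permutes {1..r}. c * (a (inv p \<circ> s) * \<chi> (inv p \<circ> s)) * \<chi> s)"
      unfolding group_ring_mult_permutes[OF True]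
      by (rule sum.cong) (auto simp: char_elem_def 1)
    also have "\<dots> = (\<Sum>p | p permutes {1..r}. c * (a p * \<chi> p) * \<chi> s)"
      by (rule sum_permutes_inv_comp[OF True, of "\<lambda>p. c * (a p * \<chi> p) * \<chi> s"])
    finally show ?thesis using True
      by (simp add: char_elem_def char_sum_def sum_distrib_right sum_distrib_left)
  qed (simp add: group_ring_mult_outside char_elem_def)
qed

text \<open>The substitution \<open>s = p \<circ> q\<close> separates the double sum.\<close>

lemma char_sum_group_ring_mult:
  assumes "linear_character r \<chi>"
  shows "char_sum r \<chi> (group_ring_mult r a b) = char_sum r \<chi> a * char_sum r \<chi> b"
proof -
  let ?P = "{p. p permutes {1..r}}"
  have "char_sum r \<chi> (group_ring_mult r a b) = (\<Sum>s\<in>?P. \<Sum>p\<in>?P. a p * b (inv p \<circ> s) * \<chi> s)"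
    unfolding char_sum_def by (rule sum.cong) (auto simp: group_ring_mult_permutes sum_distrib_right)
  also have "\<dots> = (\<Sum>p\<in>?P. \<Sum>s\<in>?P. a p * b (inv p \<circ> s) * \<chi> s)"
    by (rule sum.swap)
  also have "\<dots> = (\<Sum>p\<in>?P. \<Sum>q\<in>?P. a p * b q * \<chi> (p \<circ> q))"
  proof (rule sum.cong[OF refl])
    fix p assume "p \<in> ?P"
    then show "(\<Sum>s\<in>?P. a p * b (inv p \<circ> s) * \<chi> s) = (\<Sum>q\<in>?P. a p * b q * \<chi> (p \<circ> q))"
      using sum_permutes_translate(1)[of p r "\<lambda>s. a p * b (inv p \<circ> s) * \<chi> s"]
      by (simp add: permutes_inv_comp)
  qed
  also have "\<dots> = (\<Sum>p\<in>?P. \<Sum>q\<in>?P. (a p * \<chi> p) * (b q * \<chi> q))"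
    using assms by (intro sum.cong refl) (auto simp: linear_character_def)
  finally show ?thesis by (simp add: char_sum_def sum_product)
qed

lemma char_elem_add: "char_elem r \<chi> c + char_elem r \<chi> d = char_elem r \<chi> (c + d)"
  by (auto simp: char_elem_def fun_eq_iff distrib_right)

section \<open>Ideals attached to linear characters\<close>

lemma two_sided_ideal_char_elems:
  assumes "linear_character r \<chi>"
  shows "two_sided_ideal r (range (char_elem r \<chi>))"
proof -
  have "char_elem r \<chi> 0 = 0" by (simp add: char_elem_def fun_eq_iff)
  then have "0 \<in> range (char_elem r \<chi>)" by (metis rangeI)
  then show ?thesis
    unfolding two_sided_ideal_def right_ideal_def
    by (simp add: image_subset_iff char_elem_in_group_ring char_elem_add
        group_ring_mult_char_elem_right[OF assms] group_ring_mult_char_elem_left[OF assms])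
qed

text \<open>Right multiplication by a scaled permutation; \<open>q = id\<close> gives closure under
  scalars.\<close>

lemma right_ideal_scale:
  assumes "right_ideal r I" "a \<in> I" "q permutes {1..r}"
  shows "(\<lambda>s. if s permutes {1..r} then a (s \<circ> inv q) * c else 0) \<in> I"
proof -
  have "group_ring_mult r a (scaled_perm c q) \<in> I"
    using assms scaled_perm_in_group_ring[OF assms(3)] unfolding right_ideal_def by blast
  moreover have "group_ring_mult r a (scaled_perm c q) = (\<lambda>s. if s permutes {1..r} then a (s \<circ> inv q) * c else 0)"
    using assms(3) by (auto simp: fun_eq_iff group_ring_mult_scaled_perm_right group_ring_mult_outside)
  ultimately show ?thesis by simp
qed

lemma minimal_two_sided_ideal_char_elems:
  assumes "linear_character r \<chi>"
  shows "minimal_two_sided_ideal r (range (char_elem r \<chi>))"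
proof -
  have "\<chi> id * \<chi> id = 1" using assms by (simp add: linear_character_def)
  then have "char_elem r \<chi> 1 id \<noteq> 0" by (auto simp: char_elem_def)
  then have "char_elem r \<chi> 1 \<noteq> 0" by (metis zero_fun_apply)
  then have "range (char_elem r \<chi>) \<noteq> {0}" by (metis rangeI singletonD)
  moreover have "J = {0} \<or> J = range (char_elem r \<chi>)"
    if J: "two_sided_ideal r J" "J \<subseteq> range (char_elem r \<chi>)" for J
  proof (cases "J = {0}")
    case False
    have rJ: "right_ideal r J" using J(1) by (simp add: two_sided_ideal_def)
    then obtain a where a: "a \<in> J" "a \<noteq> 0"
      using False unfolding right_ideal_def by blast
    then obtain c where c: "a = char_elem r \<chi> c" using J(2) by blast
    have "c \<noteq> 0" using a(2) c by (auto simp: char_elem_def fun_eq_iff split: if_splits)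
    have "char_elem r \<chi> d \<in> J" for d
    proof -
      have "(\<lambda>s. if s permutes {1..r} then a (s \<circ> inv id) * (d / c) else 0) = char_elem r \<chi> d"
        using \<open>c \<noteq> 0\<close> by (auto simp: c char_elem_def fun_eq_iff)
      then show ?thesis using right_ideal_scale[OF rJ a(1) permutes_id, of "d / c"] by simp
    qed
    then show ?thesis using J(2) by blast
  qed simp
  ultimately show ?thesis
    using two_sided_ideal_char_elems[OF assms] by (simp add: minimal_two_sided_ideal_def)
qed

text \<open>Multiplying \<open>a\<close> by the elements of the character line gives the whole line,
  because \<open>char_sum r \<chi> a\<close> is invertible; minimality then forces equality.\<close>

lemma minimal_right_ideal_eq_char_elems:
  assumes \<chi>: "linear_character r \<chi>" and I: "minimal_right_ideal r I"
    and a: "a \<in> I" "char_sum r \<chi> a \<noteq> 0"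
  shows "I = range (char_elem r \<chi>)"
proof -
  have "char_elem r \<chi> c \<in> I" for c
  proof -
    have "group_ring_mult r a (char_elem r \<chi> (c / char_sum r \<chi> a)) \<in> I"
      using I a(1) by (simp add: minimal_right_ideal_def right_ideal_def char_elem_in_group_ring)
    then show ?thesis using a(2) by (simp add: group_ring_mult_char_elem_right[OF \<chi>])
  qed
  then have "range (char_elem r \<chi>) \<subseteq> I" by blast
  moreover have "right_ideal r (range (char_elem r \<chi>))" "range (char_elem r \<chi>) \<noteq> {0}"
    using minimal_two_sided_ideal_char_elems[OF \<chi>]
    by (auto simp: minimal_two_sided_ideal_def two_sided_ideal_def)
  moreover have "J = {0} \<or> J = I" if "right_ideal r J" "J \<subseteq> I" for J
    using I that by (simp add: minimal_right_ideal_def)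
  ultimately show ?thesis by metis
qed

lemma minimal_right_ideal_cases:
  assumes "minimal_right_ideal r I"
  shows "I = range (char_elem r (\<lambda>_. 1)) \<or> I = range (char_elem r sign_char) \<or> I \<subseteq> nonlinear_part r"
proof (rule ccontr)
  assume *: "\<not> ?thesis"
  have "char_sum r (\<lambda>_. 1) a = 0" "char_sum r sign_char a = 0" if "a \<in> I" for a
    using minimal_right_ideal_eq_char_elems[OF linear_character_trivial assms that]
      minimal_right_ideal_eq_char_elems[OF linear_character_sign assms that] * by argo+
  moreover have "I \<subseteq> group_ring r"
    using assms by (simp add: minimal_right_ideal_def right_ideal_def)
  ultimately have "I \<subseteq> nonlinear_part r" by (auto simp: nonlinear_part_def)
  with * show False by simp
qed

text \<open>Reindexing the sum by \<open>q \<circ> p\<close> replaces \<open>v\<close> by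
  \<open>v \<circ> q\<close> at the cost of the factor \<open>\<chi> q\<close>, whose square is
  1.\<close>

lemma symmetry_class_char_elems:
  assumes "linear_character r \<chi>" "U \<in> symmetry_class sc r (range (char_elem r \<chi>))" "q permutes {1..r}"
  shows "U (v \<circ> q) = \<chi> q * U v"
proof -
  obtain c T where U: "U = symmetry_operator r (char_elem r \<chi> c) T"
    using assms(2) by (auto simp: symmetry_class_def)
  let ?P = "{p. p permutes {1..r}}"
  have "\<chi> q * U v = (\<Sum>p\<in>?P. \<chi> q * (c * \<chi> p * T (v \<circ> p)))"
    by (simp add: U symmetry_operator_def char_elem_def sum_distrib_left)
  also have "\<dots> = (\<Sum>p\<in>?P. \<chi> q * (c * \<chi> (q \<circ> p) * T (v \<circ> (q \<circ> p))))"
    by (rule sum_permutes_translate(1)[OF assms(3), symmetric])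
  also have "\<dots> = (\<Sum>p\<in>?P. (\<chi> q * \<chi> q) * (c * \<chi> p * T (v \<circ> q \<circ> p)))"
    using assms by (intro sum.cong refl) (auto simp: linear_character_def comp_assoc)
  also have "\<dots> = U (v \<circ> q)"
    using assms(1) by (simp add: U symmetry_operator_def char_elem_def linear_character_def)
  finally show ?thesis ..
qed

section \<open>The nonlinear part of the group ring for r = 3 and r = 2\<close>

lemma permutes_3:
  "{p. p permutes {1..3::nat}} = set [id, transpose 1 2, transpose 1 3, transpose 2 3,
     transpose 1 2 \<circ> transpose 2 3, transpose 2 3 \<circ> transpose 1 2]" (is "_ = set ?ps")
  and distinct_permutes_3:
  "distinct [id, transpose 1 2, transpose 1 3, transpose 2 3 :: nat \<Rightarrow> nat,
     transpose 1 2 \<circ> transpose 2 3, transpose 2 3 \<circ> transpose 1 2]"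
proof -
  \<comment> \<open>The values at 1 and 2 already separate the six permutations; the count 3! then
    shows that the list is complete.\<close>
  have "distinct (map (\<lambda>p. (p 1, p 2)) ?ps)" by (simp add: transpose_def)
  then show distinct: "distinct ?ps" unfolding distinct_map by blast
  have "set ?ps \<subseteq> {p. p permutes {1..3}}"
    by (auto intro!: permutes_comp permutes_swap_id permutes_id)
  moreover have "card {p. p permutes {1..3::nat}} = 6"
    by (subst card_permutations[of _ 3]) (auto simp: fact_numeral)
  moreover have "card (set ?ps) = 6"
    unfolding distinct_card[OF distinct] by simp
  ultimately show "{p. p permutes {1..3}} = set ?ps"
    using card_subset_eq[of "{p. p permutes {1..3::nat}}"] finite_permutes by metis
qed

lemma sum_permutes_3:
  "(\<Sum>p | p permutes {1..3::nat}. F p) = F id + F (transpose 1 2) + F (transpose 1 3) + F (transpose 2 3)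
     + F (transpose 1 2 \<circ> transpose 2 3) + F (transpose 2 3 \<circ> transpose 1 2)"
  unfolding permutes_3 sum.distinct_set_conv_list[OF distinct_permutes_3] by (simp add: add.assoc)

lemma sign_char_3:
  "sign_char id = 1" "sign_char (transpose 1 2) = - 1" "sign_char (transpose 1 3) = - 1"
  "sign_char (transpose 2 3) = - 1" "sign_char (transpose 1 2 \<circ> transpose 2 3) = 1"
  "sign_char (transpose 2 3 \<circ> transpose 1 2) = 1"
  by (simp_all add: sign_char_def sign_swap_id sign_compose permutation_swap_id)

lemma char_sum_add: "char_sum r \<chi> (a + b) = char_sum r \<chi> a + char_sum r \<chi> b"
  by (simp add: char_sum_def distrib_right sum.distrib)

lemma two_sided_ideal_nonlinear_part:
  "two_sided_ideal r (nonlinear_part r :: ((nat \<Rightarrow> nat) \<Rightarrow> 'k::field) set)"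
proof -
  have "0 \<in> (nonlinear_part r :: ((nat \<Rightarrow> nat) \<Rightarrow> 'k) set)" by (simp add: nonlinear_part_def char_sum_def group_ring_def)
  moreover have "a + b \<in> nonlinear_part r" if "a \<in> nonlinear_part r" "b \<in> nonlinear_part r"
    for a b :: "(nat \<Rightarrow> nat) \<Rightarrow> 'k"
    using that by (simp add: nonlinear_part_def char_sum_add group_ring_def)
  ultimately show ?thesis
    unfolding two_sided_ideal_def right_ideal_def
    by (simp add: nonlinear_part_def group_ring_mult_in_group_ring char_sum_group_ring_mult
        linear_character_trivial linear_character_sign Collect_mono_iff subset_iff)
qed

lemma right_ideal_sum:
  assumes "right_ideal r I" "finite S" "\<And>x. x \<in> S \<Longrightarrow> f x \<in> I"
  shows "(\<lambda>s. \<Sum>x\<in>S. f x s) \<in> I"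
  using assms(2,3)
proof (induction S)
  case empty
  then show ?case using assms(1) by (simp add: right_ideal_def zero_fun_def)
next
  case (insert x S)
  then have "f x \<in> I" "(\<lambda>s. \<Sum>x\<in>S. f x s) \<in> I" by auto
  then have "f x + (\<lambda>s. \<Sum>x\<in>S. f x s) \<in> I" using assms(1) by (simp add: right_ideal_def)
  then show ?case using insert(1,2) by (simp add: plus_fun_def)
qed

text \<open>The sum of all conjugates of \<open>a\<close>, not divided by the group order.\<close>

definition class_average ::
  "nat \<Rightarrow> ((nat \<Rightarrow> nat) \<Rightarrow> 'k::field) \<Rightarrow> (nat \<Rightarrow> nat) \<Rightarrow> 'k" where
  "class_average r a = (\<lambda>s. \<Sum>g | g permutes {1..r}. if s permutes {1..r} then a (inv g \<circ> s \<circ> g) else 0)"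

text \<open>Conjugation is left multiplication by \<open>g\<close> followed by right multiplication
  by \<open>inv g\<close>.\<close>

lemma class_average_in_ideal:
  assumes "two_sided_ideal r J" "a \<in> J"
  shows "class_average r a \<in> J"
proof -
  have J: "right_ideal r J" using assms(1) by (simp add: two_sided_ideal_def)
  have "(\<lambda>s. if s permutes {1..r} then a (inv g \<circ> s \<circ> g) else 0) \<in> J" if g: "g permutes {1..r}" for g
  proof -
    let ?b = "group_ring_mult r (scaled_perm 1 g) a"
    have b: "?b \<in> J"
      using assms scaled_perm_in_group_ring[OF g] unfolding two_sided_ideal_def by blast
    have "(\<lambda>s. if s permutes {1..r} then ?b (s \<circ> inv (inv g)) * 1 else 0)
        = (\<lambda>s. if s permutes {1..r} then a (inv g \<circ> s \<circ> g) else 0)"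
      using g by (auto simp: fun_eq_iff group_ring_mult_scaled_perm_left permutes_comp
          permutes_inv_inv comp_assoc)
    then show ?thesis using right_ideal_scale[OF J b permutes_inv[OF g], of 1] by simp
  qed
  then show ?thesis
    unfolding class_average_def by (intro right_ideal_sum[OF J finite_permutes]) simp
qed

lemma class_average_conjugate:
  assumes "h permutes {1..r}" "s permutes {1..r}"
  shows "class_average r a (h \<circ> s \<circ> inv h) = class_average r a s"
proof -
  have "inv (h \<circ> g) \<circ> (h \<circ> s \<circ> inv h) \<circ> (h \<circ> g) = inv g \<circ> s \<circ> g" if "g permutes {1..r}" for g
    unfolding o_inv_distrib[OF permutes_bij[OF assms(1)] permutes_bij[OF that]]
    by (simp add: fun_eq_iff permutes_inverses[OF assms(1)])
  then show ?thesis
    using sum_permutes_translate(1)[OF assms(1), of "\<lambda>g. a (inv g \<circ> (h \<circ> s \<circ> inv h) \<circ> g)"] assms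
    by (simp add: class_average_def permutes_comp permutes_inv)
qed

lemma class_average_id: "class_average r a id = of_nat (card {p. p permutes {1..r}}) * a id"
proof -
  have "a (inv g \<circ> id \<circ> g) = a id" if "g permutes {1..r}" for g
    using that by (simp add: permutes_inv_o)
  then show ?thesis by (simp add: class_average_def)
qed

text \<open>Both sums are values of the product of a character element with \<open>x\<close>, which
  is scaled by the vanishing character sum of \<open>x\<close>.\<close>

lemma nonlinear_part_row_sums:
  assumes "x \<in> nonlinear_part r" "s permutes {1..r}"
  shows "(\<Sum>p | p permutes {1..r}. x (inv p \<circ> s)) = 0"
    "(\<Sum>p | p permutes {1..r}. sign_char p * x (inv p \<circ> s)) = 0"
proof -
  have *: "(\<Sum>p | p permutes {1..r}. \<chi> p * x (inv p \<circ> s)) = 0"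
    if "linear_character r \<chi>" "char_sum r \<chi> x = 0" for \<chi>
  proof -
    have "(\<Sum>p | p permutes {1..r}. \<chi> p * x (inv p \<circ> s)) = group_ring_mult r (char_elem r \<chi> 1) x s"
      unfolding group_ring_mult_permutes[OF assms(2)] by (rule sum.cong) (auto simp: char_elem_def)
    also have "\<dots> = 0"
      unfolding group_ring_mult_char_elem_left[OF that(1)] that(2) by (simp add: char_elem_def)
    finally show ?thesis .
  qed
  show "(\<Sum>p | p permutes {1..r}. x (inv p \<circ> s)) = 0"
    "(\<Sum>p | p permutes {1..r}. sign_char p * x (inv p \<circ> s)) = 0"
    using *[OF linear_character_trivial] *[OF linear_character_sign] assms(1)
    by (simp_all add: nonlinear_part_def)
qed

text \<open>The vanishing character sums make the average 6, 0 and -3 times \<open>a id\<close> on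
  the identity, the transpositions and the 3-cycles. This is a multiple of the irreducible character
  of degree 2, hence it acts as a scalar; \<open>rows\<close> yields 6 + 3 = 9.\<close>

lemma class_average_nonlinear_part_3:
  fixes a :: "(nat \<Rightarrow> nat) \<Rightarrow> 'k::field_char_0"
  assumes b: "class_average 3 a \<in> nonlinear_part 3"
    and x: "x \<in> nonlinear_part 3" and s: "s permutes {1..3}"
  shows "group_ring_mult 3 (class_average 3 a) x s = 9 * a id * x s"
proof -
  let ?b = "class_average 3 a"
  let ?t = "transpose 1 2 :: nat \<Rightarrow> nat" and ?c = "transpose 1 2 \<circ> transpose 2 3 :: nat \<Rightarrow> nat"
    and ?c' = "transpose 2 3 \<circ> transpose 1 2 :: nat \<Rightarrow> nat"
  have perms: "transpose i j permutes {1..3}" if "i \<in> {1..3}" "j \<in> {1..3}" for i j :: nat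
    using that by (rule permutes_swap_id)
  have "?b (transpose 2 3 \<circ> ?t \<circ> transpose 2 3) = ?b ?t" "?b (transpose 1 3 \<circ> ?t \<circ> transpose 1 3) = ?b ?t"
    "?b (?t \<circ> ?c \<circ> ?t) = ?b ?c"
    using class_average_conjugate[of "transpose 2 3" 3 ?t a] class_average_conjugate[of "transpose 1 3" 3 ?t a]
      class_average_conjugate[of ?t 3 ?c a] by (simp_all add: perms permutes_comp)
  moreover have "transpose 2 3 \<circ> ?t \<circ> transpose 2 3 = transpose 1 3"
    "transpose 1 3 \<circ> ?t \<circ> transpose 1 3 = transpose 2 3" "?t \<circ> ?c \<circ> ?t = ?c'"
    by (auto simp: fun_eq_iff transpose_def)
  ultimately have class_eq: "?b (transpose 1 3) = ?b ?t" "?b (transpose 2 3) = ?b ?t" "?b ?c' = ?b ?c"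
    by simp_all
  have id: "?b id = 6 * a id"
    using class_average_id[of 3 a] card_permutations[of "{1..3::nat}" 3] by (simp add: fact_numeral)
  have sums: "?b id + 3 * ?b ?t + 2 * ?b ?c = 0" "?b id - 3 * ?b ?t + 2 * ?b ?c = 0"
    using b by (simp_all add: nonlinear_part_def char_sum_def sum_permutes_3 sign_char_3 class_eq algebra_simps)
  then have "6 * ?b ?t = 0" by algebra
  then have t: "?b ?t = 0" by simp
  then have "2 * (?b ?c + 3 * a id) = 0" using sums(1) id by algebra
  then have c: "?b ?c = - 3 * a id" unfolding mult_eq_0_iff by (simp add: eq_neg_iff_add_eq_0)
  \<comment> \<open>Adding the plain and the signed row sum cancels the transpositions and doubles
    the even permutations.\<close>
  have "2 * (x s + x (inv ?c \<circ> s) + x (inv ?c' \<circ> s)) = 0"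
    using nonlinear_part_row_sums[OF x s] unfolding sum_permutes_3 sign_char_3 by (simp; algebra)
  then have rows: "x s + x (inv ?c \<circ> s) + x (inv ?c' \<circ> s) = 0" unfolding mult_eq_0_iff by simp
  have "group_ring_mult 3 ?b x s = 6 * a id * x s - 3 * a id * (x (inv ?c \<circ> s) + x (inv ?c' \<circ> s))"
    by (simp add: group_ring_mult_permutes[OF s] sum_permutes_3 class_eq t c id algebra_simps)
  then show ?thesis using rows by algebra
qed

text \<open>The average over conjugates of \<open>a \<noteq> 0\<close> in a two-sided ideal inside the nonlinear part is central
  in the group ring, hence for \<open>r = 3\<close> a multiple of the unit of that part, and it is nonzero if
  \<open>a\<close> is translated such that \<open>a id \<noteq> 0\<close>.\<close>

lemma minimal_two_sided_ideal_nonlinear_part_3: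
  "minimal_two_sided_ideal 3 (nonlinear_part 3 :: ((nat \<Rightarrow> nat) \<Rightarrow> 'k::field_char_0) set)"
proof -
  let ?Z = "nonlinear_part 3 :: ((nat \<Rightarrow> nat) \<Rightarrow> 'k) set"
  \<comment> \<open>The identity minus a 3-cycle: both are even, so both character sums
    vanish.\<close>
  define d :: "(nat \<Rightarrow> nat) \<Rightarrow> 'k" where
    "d = (\<lambda>p. if p = id then 1 else if p = transpose 1 2 \<circ> transpose 2 3 then - 1 else 0)"
  have "d \<in> group_ring 3"
    by (auto simp: d_def group_ring_def intro!: permutes_comp permutes_swap_id permutes_id)
  then have "d \<in> ?Z"
    using distinct_permutes_3
    by (simp add: nonlinear_part_def char_sum_def sum_permutes_3 sign_char_3) (auto simp: d_def)
  moreover have "d id \<noteq> 0" by (simp add: d_def)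
  ultimately have "?Z \<noteq> {0}" by auto
  moreover have "J = {0} \<or> J = ?Z" if J: "two_sided_ideal 3 J" "J \<subseteq> ?Z" for J
  proof (cases "J = {0}")
    case False
    have rJ: "right_ideal 3 J" using J(1) by (simp add: two_sided_ideal_def)
    then obtain a' where a': "a' \<in> J" "a' \<noteq> 0" using False unfolding right_ideal_def by blast
    then obtain p where p: "a' p \<noteq> 0" by (auto simp: fun_eq_iff)
    then have perm: "p permutes {1..3}"
      using a' rJ by (auto simp: right_ideal_def group_ring_def)
    \<comment> \<open>Translation moves the nonzero value of \<open>a'\<close> at \<open>p\<close>
      to the identity.\<close>
    define a where "a = (\<lambda>s. if s permutes {1..3} then a' (s \<circ> inv (inv p)) * 1 else 0)"
    have "a \<in> J" unfolding a_def by (rule right_ideal_scale[OF rJ a'(1) permutes_inv[OF perm]])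
    have a_id: "a id \<noteq> 0" using p perm by (simp add: a_def permutes_id permutes_inv_inv)
    have b: "class_average 3 a \<in> J" by (rule class_average_in_ideal[OF J(1) \<open>a \<in> J\<close>])
    have "x \<in> J" if x: "x \<in> ?Z" for x
    proof -
      have "x \<in> group_ring 3" using x by (simp add: nonlinear_part_def)
      then have "group_ring_mult 3 (class_average 3 a) x \<in> J"
        using rJ b by (simp add: right_ideal_def)
      \<comment> \<open>The product is \<open>9 * a id\<close> times \<open>x\<close> on the
        permutations; the scalar undoes this factor.\<close>
      from right_ideal_scale[OF rJ this permutes_id, of "1 / (9 * a id)"]
      have "(\<lambda>s. if s permutes {1..3} then x s else 0) \<in> J"
        using b J(2) x a_id by (simp add: class_average_nonlinear_part_3 subset_iff cong: if_cong)
      moreover have "(\<lambda>s. if s permutes {1..3} then x s else 0) = x"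
        using \<open>x \<in> group_ring 3\<close> by (auto simp: group_ring_def fun_eq_iff)
      ultimately show ?thesis by simp
    qed
    then show ?thesis using J(2) by blast
  qed simp
  ultimately show ?thesis
    using two_sided_ideal_nonlinear_part by (simp add: minimal_two_sided_ideal_def)
qed

text \<open>The two character sums are the sum and the difference of the two coefficients.\<close>

lemma nonlinear_part_2: "nonlinear_part 2 = {0 :: (nat \<Rightarrow> nat) \<Rightarrow> 'k::field_char_0}"
proof -
  have "a p = 0" if a: "a \<in> nonlinear_part 2" for a :: "(nat \<Rightarrow> nat) \<Rightarrow> 'k" and p
  proof -
    have perms: "{p. p permutes {1..2}} = {id, transpose 1 (2::nat)}"
      using permutes_doubleton_iff[of _ 1 "2::nat"] by (auto simp: atLeastAtMost_insertL[symmetric])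
    have ne: "id \<noteq> transpose 1 (2::nat)" by (metis id_apply n_not_Suc_n one_add_one plus_1_eq_Suc transpose_apply_first)
    have "a id + a (transpose 1 2) = 0" "a id - a (transpose 1 2) = 0"
      using a ne by (auto simp: nonlinear_part_def char_sum_def perms sign_char_def sign_swap_id)
    then have "2 * a id = 0" "2 * a (transpose 1 2) = 0" by algebra+
    then have "a id = 0" "a (transpose 1 2) = 0" by simp_all
    moreover have "p = id \<or> p = transpose 1 2" if "p permutes {1..2}" using that perms by blast
    ultimately show ?thesis
      using a by (cases "p permutes {1..2}") (auto simp: nonlinear_part_def group_ring_def)
  qed
  then have "nonlinear_part 2 \<subseteq> {0 :: (nat \<Rightarrow> nat) \<Rightarrow> 'k}" by (auto simp: fun_eq_iff)
  moreover have "0 \<in> nonlinear_part 2"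
    using two_sided_ideal_nonlinear_part unfolding two_sided_ideal_def right_ideal_def by blast
  ultimately show ?thesis by blast
qed

section \<open>Young symmetrizers\<close>

text \<open>A Young symmetrizer is the row sum times the signed column sum, and
  \<open>\<chi>\<close> is multiplicative; the pairs of a row and a column permutation are grouped
  by their composition.\<close>

lemma char_sum_young_symmetrizer:
  assumes \<chi>: "linear_character r \<chi>"
  shows "char_sum r \<chi> (young_symmetrizer r t)
    = (\<Sum>p\<in>row_permutations r t. \<chi> p) * (\<Sum>q\<in>column_permutations r t. sign_char q * \<chi> q)"
proof -
  let ?P = "{p. p permutes {1..r}}"
  let ?R = "row_permutations r t" and ?C = "column_permutations r t"
  let ?h = "\<lambda>(p, q). \<chi> p * (sign_char q * \<chi> q)"
  have sub: "?R \<subseteq> ?P" "?C \<subseteq> ?P" by (auto simp: row_permutations_def column_permutations_def)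
  then have fin: "finite (?R \<times> ?C)" using finite_permutes finite_subset by blast
  have "char_sum r \<chi> (young_symmetrizer r t)
      = (\<Sum>s\<in>?P. \<Sum>x\<in>{x \<in> ?R \<times> ?C. (case x of (p, q) \<Rightarrow> p \<circ> q) = s}. ?h x)"
    unfolding char_sum_def
  proof (rule sum.cong[OF refl])
    fix s assume "s \<in> ?P"
    have "young_symmetrizer r t s * \<chi> s
        = (\<Sum>(p, q)\<in>{(p, q). p \<in> ?R \<and> q \<in> ?C \<and> p \<circ> q = s}. sign_char q * \<chi> s)"
      by (simp add: young_symmetrizer_def sign_char_def sum_distrib_right case_prod_unfold)
    also have "\<dots> = (\<Sum>x\<in>{x \<in> ?R \<times> ?C. (case x of (p, q) \<Rightarrow> p \<circ> q) = s}. ?h x)"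
    proof (rule sum.cong)
      fix x assume "x \<in> {x \<in> ?R \<times> ?C. (case x of (p, q) \<Rightarrow> p \<circ> q) = s}"
      moreover obtain p q where x_eq: "x = (p, q)" by (cases x)
      ultimately have "p \<in> ?R" "q \<in> ?C" "s = p \<circ> q" by simp_all
      then have x: "x = (p, q)" "p permutes {1..r}" "q permutes {1..r}" "s = p \<circ> q"
        using sub x_eq by blast+
      then have "\<chi> s = \<chi> p * \<chi> q" using \<chi> by (simp add: linear_character_def)
      then show "(case x of (p, q) \<Rightarrow> sign_char q * \<chi> s) = ?h x" using x by simp
    qed auto
    finally show "young_symmetrizer r t s * \<chi> s
      = (\<Sum>x\<in>{x \<in> ?R \<times> ?C. (case x of (p, q) \<Rightarrow> p \<circ> q) = s}. ?h x)" .
  qed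
  also have "\<dots> = (\<Sum>x\<in>?R \<times> ?C. ?h x)"
  proof (rule sum.group[OF fin finite_permutes])
    show "(\<lambda>x. case x of (p, q) \<Rightarrow> p \<circ> q) ` (?R \<times> ?C) \<subseteq> ?P"
      using sub permutes_comp by fastforce
  qed
  also have "\<dots> = (\<Sum>p\<in>?R. \<chi> p) * (\<Sum>q\<in>?C. sign_char q * \<chi> q)"
    by (simp add: sum_product sum.cartesian_product)
  finally show ?thesis .
qed

lemma young_symmetrizer_in_group_ring: "young_symmetrizer r t \<in> group_ring r"
  unfolding group_ring_def young_symmetrizer_def
  by (auto intro!: sum.neutral simp: row_permutations_def column_permutations_def permutes_comp)

text \<open>Composition with the transposition is an involution of \<open>G\<close> that reverses
  signs.\<close>

lemma sum_sign_char_eq_0: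
  fixes G :: "(nat \<Rightarrow> nat) set"
  assumes "G \<subseteq> {p. p permutes {1..r}}" "i \<in> {1..r}" "j \<in> {1..r}" "i \<noteq> j"
    and closed: "\<And>p. p \<in> G \<Longrightarrow> p \<circ> transpose i j \<in> G"
  shows "(\<Sum>p\<in>G. sign_char p :: 'k::field_char_0) = 0"
proof -
  let ?S = "\<Sum>p\<in>G. sign_char p :: 'k"
  have invol: "p \<circ> transpose i j \<circ> transpose i j = p" for p :: "nat \<Rightarrow> nat" by (simp add: comp_assoc)
  have flip: "sign_char (p \<circ> transpose i j) = (- sign_char p :: 'k)" if "p \<in> G" for p
    using that assms sign_comp_permutes[OF _ permutes_swap_id[OF assms(2,3)], of p]
    by (auto simp: sign_char_def sign_swap_id)
  have "?S = (\<Sum>p\<in>G. sign_char (p \<circ> transpose i j))"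
    by (rule sum.reindex_bij_witness[where i = "\<lambda>p. p \<circ> transpose i j" and j = "\<lambda>p. p \<circ> transpose i j"])
       (simp_all add: closed invol)
  also have "\<dots> = - ?S" using flip by (simp add: sum_negf)
  finally have "2 * ?S = 0" by simp
  then show ?thesis by simp
qed

lemma tableau_column_image: "tableau_column t j = (\<lambda>row. row ! j) ` {row \<in> set t. j < length row}"
  by (auto simp: tableau_column_def)

text \<open>The frame has a row and a column of length 2. For the trivial character the column
  factor of a symmetrizer is a vanishing sum of signs, for the sign character the row factor is; so
  all symmetrizers lie in \<open>nonlinear_part 3\<close>.\<close>

lemma belongs_to_21:
  assumes "I \<subseteq> nonlinear_part 3"
  shows "belongs_to 3 (I :: ((nat \<Rightarrow> nat) \<Rightarrow> 'k::field_char_0) set) [2, 1]"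
proof -
  have "young_symmetrizer 3 t \<in> (nonlinear_part 3 :: ((nat \<Rightarrow> nat) \<Rightarrow> 'k) set)"
    if t: "young_tableau 3 [2, 1] t" for t
  proof -
    obtain x y z where t_eq: "t = [[x, y], [z]]"
      using t by (auto simp: young_tableau_def length_Suc_conv numeral_2_eq_2 One_nat_def)
    have xyz: "x \<noteq> y" "x \<noteq> z" "y \<noteq> z" "x \<in> {1..3}" "y \<in> {1..3}" "z \<in> {1..3}"
      using t by (auto simp: young_tableau_def t_eq)
    have column: "tableau_column t j = (if j = 0 then {x, z} else if j = 1 then {y} else {})" for j
    proof -
      have "{row \<in> set t. j < length row} = (if j = 0 then {[x, y], [z]} else if j = 1 then {[x, y]} else {})"
        by (auto simp: t_eq One_nat_def)
      then show ?thesis by (simp add: tableau_column_image One_nat_def)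
    qed
    have rows: "(\<Sum>p\<in>row_permutations 3 t. sign_char p :: 'k) = 0"
    proof (rule sum_sign_char_eq_0[of _ 3 x y])
      have "(p \<circ> transpose x y) ` set row = p ` set row" if "row \<in> set t" for p and row
        using that xyz unfolding image_comp[symmetric] by (auto simp: transpose_def t_eq)
      then show "p \<circ> transpose x y \<in> row_permutations 3 t" if "p \<in> row_permutations 3 t" for p
        using that permutes_comp[OF _ permutes_swap_id[OF xyz(4,5)]]
        unfolding row_permutations_def mem_Collect_eq by metis
    qed (use xyz in \<open>auto simp: row_permutations_def\<close>)
    have columns: "(\<Sum>q\<in>column_permutations 3 t. sign_char q :: 'k) = 0"
    proof (rule sum_sign_char_eq_0[of _ 3 x z])
      have "(p \<circ> transpose x z) ` tableau_column t j = p ` tableau_column t j" for p and j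
        using xyz unfolding image_comp[symmetric] by (auto simp: transpose_def column)
      then show "p \<circ> transpose x z \<in> column_permutations 3 t" if "p \<in> column_permutations 3 t" for p
        using that permutes_comp[OF _ permutes_swap_id[OF xyz(4,6)]]
        unfolding column_permutations_def mem_Collect_eq by metis
    qed (use xyz in \<open>auto simp: column_permutations_def\<close>)
    show ?thesis
      using rows columns
      by (simp add: nonlinear_part_def young_symmetrizer_in_group_ring
          char_sum_young_symmetrizer linear_character_trivial linear_character_sign)
  qed
  then show ?thesis
    using assms minimal_two_sided_ideal_nonlinear_part_3
    unfolding belongs_to_def partition_of_def by (intro conjI exI[of _ "nonlinear_part 3"]) auto
qed

text \<open>The single row admits all permutations and the columns only the identity, so the
  symmetrizer is the sum of all permutations.\<close>

lemma belongs_to_one_row: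
  assumes "0 < r"
  shows "belongs_to r (range (char_elem r (\<lambda>_. 1 :: 'k::field))) [r]"
proof -
  have "young_symmetrizer r t = char_elem r (\<lambda>_. 1 :: 'k) 1" if t: "young_tableau r [r] t" for t
  proof
    fix s
    obtain row where t_eq: "t = [row]" and row: "length row = r" "set row = {1..r}"
      using t by (auto simp: young_tableau_def)
    have rows: "row_permutations r t = {p. p permutes {1..r}}"
      by (simp add: row_permutations_def t_eq row permutes_image cong: conj_cong)
    have column: "tableau_column t j = (if j < r then {row ! j} else {})" for j
      by (auto simp: tableau_column_def t_eq row)
    have "q = id" if q: "q \<in> column_permutations r t" for q
    proof
      fix x
      show "q x = id x"
      proof (cases "x \<in> {1..r}")
        case True
        then obtain j where "j < r" "x = row ! j" using row by (metis in_set_conv_nth)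
        then show ?thesis using q column[of j] by (auto simp: column_permutations_def)
      next
        case False
        then show ?thesis using q permutes_not_in by (fastforce simp: column_permutations_def)
      qed
    qed
    then have columns: "column_permutations r t = {id}"
      by (auto simp: column_permutations_def permutes_id)
    have "{(p, q). p \<in> row_permutations r t \<and> q \<in> column_permutations r t \<and> p \<circ> q = s}
        = (if s permutes {1..r} then {(s, id)} else {})"
      unfolding rows columns by auto
    then show "young_symmetrizer r t s = char_elem r (\<lambda>_. 1 :: 'k) 1 s"
      by (simp add: young_symmetrizer_def char_elem_def)
  qed
  then show ?thesis
    using assms minimal_two_sided_ideal_char_elems[OF linear_character_trivial]
    unfolding belongs_to_def partition_of_def
    by (intro conjI exI[of _ "range (char_elem r (\<lambda>_. 1 :: 'k))"]) auto
qed

text \<open>Rows and columns exchange their roles, and the symmetrizer is the signed sum.\<close>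

lemma belongs_to_11: "belongs_to 2 (range (char_elem 2 (sign_char :: _ \<Rightarrow> 'k::field))) [1, 1]"
proof -
  have "young_symmetrizer 2 t = char_elem 2 (sign_char :: _ \<Rightarrow> 'k) 1" if t: "young_tableau 2 [1, 1] t" for t
  proof
    fix s
    obtain x y where t_eq: "t = [[x], [y]]"
      using t by (auto simp: young_tableau_def length_Suc_conv One_nat_def)
    have xy: "{x, y} = {1..2}" using t by (auto simp: young_tableau_def t_eq)
    have column: "tableau_column t j = (if j = 0 then {1..2} else {})" for j
    proof -
      have "{row \<in> set t. j < length row} = (if j = 0 then {[x], [y]} else {})" by (auto simp: t_eq)
      then show ?thesis by (simp add: tableau_column_image xy)
    qed
    have columns: "column_permutations 2 t = {p. p permutes {1..2}}"
      by (simp add: column_permutations_def column permutes_image cong: conj_cong)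
    have "p = id" if p: "p \<in> row_permutations 2 t" for p
    proof
      fix z
      show "p z = id z"
      proof (cases "z \<in> {x, y}")
        case True
        then show ?thesis using p by (auto simp: row_permutations_def t_eq)
      next
        case False
        then show ?thesis using p permutes_not_in unfolding xy by (fastforce simp: row_permutations_def)
      qed
    qed
    then have rows: "row_permutations 2 t = {id}"
      by (auto simp: row_permutations_def permutes_id)
    have "{(p, q). p \<in> row_permutations 2 t \<and> q \<in> column_permutations 2 t \<and> p \<circ> q = s}
        = (if s permutes {1..2} then {(id, s)} else {})"
      unfolding rows columns by auto
    then show "young_symmetrizer 2 t s = char_elem 2 (sign_char :: _ \<Rightarrow> 'k) 1 s"
      by (simp add: young_symmetrizer_def char_elem_def sign_char_def)
  qed
  then show ?thesis
    using minimal_two_sided_ideal_char_elems[OF linear_character_sign]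
    unfolding belongs_to_def partition_of_def
    by (intro conjI exI[of _ "range (char_elem 2 (sign_char :: _ \<Rightarrow> 'k))"]) auto
qed

section \<open>Symmetry classes of orders 2 and 3\<close>

lemma tensor_span_superset: "S \<subseteq> tensor_span (S :: ((nat \<Rightarrow> 'v) \<Rightarrow> 'k::field) set)"
proof -
  interpret module "\<lambda>(c :: 'k) (T :: (nat \<Rightarrow> 'v) \<Rightarrow> 'k) v. c * T v"
    by unfold_locales (auto simp: fun_eq_iff algebra_simps)
  show ?thesis unfolding tensor_span_def by (rule span_superset)
qed

lemma symmetric_tensor_of_trivial_class:
  assumes "U \<in> symmetry_class sc r (range (char_elem r (\<lambda>_. 1)))"
  shows "symmetric_tensor r U" "transposition_eigen 1 {1..r} U"
  using symmetry_class_char_elems[OF linear_character_trivial assms]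
  by (simp_all add: symmetric_tensor_def transposition_eigen_def permutes_swap_id)

lemma skew_tensor_of_sign_class:
  assumes "U \<in> symmetry_class sc r (range (char_elem r sign_char))"
  shows "skew_tensor r U" "transposition_eigen (- 1) {1..r} U"
  using symmetry_class_char_elems[OF linear_character_sign assms]
  by (simp_all add: skew_tensor_def transposition_eigen_def permutes_swap_id sign_char_def sign_swap_id)

text \<open>The frames (3), (1 1 1) and (2 1). For the second only skew symmetry is recorded, which
  the vanishing results refute.\<close>

lemma irreducible_class_3_cases:
  fixes I :: "((nat \<Rightarrow> nat) \<Rightarrow> 'k::field_char_0) set"
  assumes "defines_irreducible_class sc 3 I" "U \<in> symmetry_class sc 3 I"
  obtains (symmetric) "belongs_to 3 I [3]" "symmetric_tensor 3 U" "transposition_eigen 1 {1..3} U"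
    | (skew) "transposition_eigen (- 1) {1..3} U"
    | (hook) "belongs_to 3 I [2, 1]"
  using minimal_right_ideal_cases[of 3 I] assms symmetric_tensor_of_trivial_class[of U sc 3]
    skew_tensor_of_sign_class[of U sc 3] belongs_to_one_row[of 3] belongs_to_21[of I]
  by (auto simp: defines_irreducible_class_def)

text \<open>A minimal right ideal is nonzero while \<open>nonlinear_part 2\<close> is zero, so only
  the two characters remain.\<close>

lemma irreducible_class_2_cases:
  fixes J :: "((nat \<Rightarrow> nat) \<Rightarrow> 'k::field_char_0) set"
  assumes "defines_irreducible_class sc 2 J" "W \<in> symmetry_class sc 2 J"
  obtains (symmetric) "belongs_to 2 J [2]" "symmetric_tensor 2 W"
    | (skew) "belongs_to 2 J [1, 1]" "skew_tensor 2 W" "transposition_eigen (- 1) {1..2} W"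
proof -
  have J: "minimal_right_ideal 2 J" using assms(1) by (simp add: defines_irreducible_class_def)
  then have "\<not> J \<subseteq> nonlinear_part 2"
    unfolding nonlinear_part_2 minimal_right_ideal_def right_ideal_def by auto
  then show thesis
    using minimal_right_ideal_cases[OF J] assms(2) symmetric_tensor_of_trivial_class[of W sc 2]
      skew_tensor_of_sign_class[of W sc 2] belongs_to_one_row[of 2] belongs_to_11 symmetric skew
    by auto
qed

text \<open>\<open>A\<close> holds the positions of \<open>U\<close>: the first three or the last
  three, according to the order of the factors.\<close>

lemma tensor_prod_3_1_symmetries:
  assumes "order_at_most 3 U" "order_at_most 1 w" "T = tensor_prod 3 U w \<or> T = tensor_prod 1 w U"
  obtains A where "order_at_most 4 T" "A \<subseteq> {1..4}" "card A = 3"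
    "\<And>e. transposition_eigen e {1..3} U \<Longrightarrow> transposition_eigen e A T"
  using assms(3)
proof
  assume T: "T = tensor_prod 3 U w"
  show thesis
    by (rule that[of "{1..3}"])
       (use order_at_most_tensor_prod[OF assms(1,2)] transposition_eigen_tensor_prod_left[OF _ assms(2)]
         in \<open>auto simp: T\<close>)
next
  assume T: "T = tensor_prod 1 w U"
  show thesis
    by (rule that[of "{1 + 1..1 + 3}"])
       (use order_at_most_tensor_prod[OF assms(2,1)] transposition_eigen_tensor_prod_right[OF assms(2), of _ 3 U]
         in \<open>auto simp: T\<close>)
qed

lemma tensor_prod_3_2_symmetries:
  assumes "order_at_most 3 U" "order_at_most 2 W" "T = tensor_prod 3 U W \<or> T = tensor_prod 2 W U"
  obtains A where "order_at_most 5 T" "A \<subseteq> {1..5}" "card A = 3"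
    "\<And>e. transposition_eigen e {1..3} U \<Longrightarrow> transposition_eigen e A T"
    "\<And>e. transposition_eigen e {1..2} W \<Longrightarrow> transposition_eigen e ({1..5} - A) T"
  using assms(3)
proof
  assume T: "T = tensor_prod 3 U W"
  have *: "{1..5} - {1..3} = {3 + 1..3 + 2::nat}" by auto
  show thesis
    by (rule that[of "{1..3}", unfolded *])
       (use order_at_most_tensor_prod[OF assms(1,2)] transposition_eigen_tensor_prod_left[OF _ assms(2)]
         transposition_eigen_tensor_prod_right[OF assms(1), of _ 2 W] in \<open>auto simp: T\<close>)
next
  assume T: "T = tensor_prod 2 W U"
  have *: "{1..5} - {2 + 1..2 + 3} = {1..2::nat}" by auto
  show thesis
    by (rule that[of "{2 + 1..2 + 3}", unfolded *])
       (use order_at_most_tensor_prod[OF assms(2,1)] transposition_eigen_tensor_prod_left[OF _ assms(1)]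
         transposition_eigen_tensor_prod_right[OF assms(2), of _ 3 U] in \<open>auto simp: T\<close>)
qed

section \<open>The admissible partitions\<close>

theorem theorem1p4:
  fixes sc :: "'k::real_normed_field \<Rightarrow> 'v::ab_group_add \<Rightarrow> 'v"
    and Basis :: "'v set"
  assumes "finite_dimensional_vector_space sc Basis"
  shows
    "(\<forall>a P T I U w.
        curvature_generator_solution sc a P \<and>
        T \<in> P \<and> symmetry_operator 4 a T \<noteq> 0 \<and>
        defines_irreducible_class sc 3 I \<and> U \<in> symmetry_class sc 3 I \<and> w \<in> tensors sc 1 \<and>
        (T = tensor_prod 3 U w \<or> T = tensor_prod 1 w U)
        \<longrightarrow> belongs_to 3 I [2, 1])
     \<and>
     (\<forall>a P T I J U W.
        derivative_curvature_generator_solution sc a P \<and>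
        T \<in> P \<and> symmetry_operator 5 a T \<noteq> 0 \<and>
        defines_irreducible_class sc 3 I \<and> U \<in> symmetry_class sc 3 I \<and>
        defines_irreducible_class sc 2 J \<and> W \<in> symmetry_class sc 2 J \<and>
        (T = tensor_prod 3 U W \<or> T = tensor_prod 2 W U)
        \<longrightarrow> belongs_to 3 I [3] \<and> belongs_to 2 J [2] \<and>
              symmetric_tensor 3 U \<and> symmetric_tensor 2 W
          \<or> belongs_to 3 I [2, 1] \<and> belongs_to 2 J [2] \<and> symmetric_tensor 2 W
          \<or> belongs_to 3 I [2, 1] \<and> belongs_to 2 J [1, 1] \<and> skew_tensor 2 W)"
proof (intro conjI allI impI; elim conjE)
  fix a P T I U w
  assume sol: "curvature_generator_solution sc a P" and T: "T \<in> P" "symmetry_operator 4 a T \<noteq> 0"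
    and I: "defines_irreducible_class sc 3 I" "U \<in> symmetry_class sc 3 I" and w: "w \<in> tensors sc 1"
    and T_eq: "T = tensor_prod 3 U w \<or> T = tensor_prod 1 w U"
  \<comment> \<open>A generating set lies in its span, so the image of each single product is itself
    a curvature tensor.\<close>
  have "symmetry_operator 4 a T \<in> curvature_tensors sc"
    using sol T(1) tensor_span_superset[of "symmetry_operator 4 a ` P"]
    unfolding curvature_generator_solution_def by blast
  note eq_0 = curvature_from_product_eq_0[OF this]
  obtain A where A: "order_at_most 4 T" "A \<subseteq> {1..4}" "card A = 3"
    "\<And>e. transposition_eigen e {1..3} U \<Longrightarrow> transposition_eigen e A T"
    using tensor_prod_3_1_symmetries[OF order_at_most_symmetry_class[OF I(2)] order_at_most_tensors[OF w] T_eq]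
    by metis
  from I show "belongs_to 3 I [2, 1]"
  proof (cases rule: irreducible_class_3_cases)
    case symmetric
    then show ?thesis using eq_0[OF A(1) A(4) _ A(2,3), of 1] T(2) by simp
  next
    case skew
    then show ?thesis using eq_0[OF A(1) A(4) _ A(2,3), of "- 1"] T(2) by simp
  qed
next
  fix a P T I J U W
  assume sol: "derivative_curvature_generator_solution sc a P" and T: "T \<in> P" "symmetry_operator 5 a T \<noteq> 0"
    and I: "defines_irreducible_class sc 3 I" "U \<in> symmetry_class sc 3 I"
    and J: "defines_irreducible_class sc 2 J" "W \<in> symmetry_class sc 2 J"
    and T_eq: "T = tensor_prod 3 U W \<or> T = tensor_prod 2 W U"
  have R: "symmetry_operator 5 a T \<in> derivative_curvature_tensors sc"
    using sol T(1) tensor_span_superset[of "symmetry_operator 5 a ` P"]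
    unfolding derivative_curvature_generator_solution_def by blast
  obtain A where A: "order_at_most 5 T" "A \<subseteq> {1..5}" "card A = 3"
    "\<And>e. transposition_eigen e {1..3} U \<Longrightarrow> transposition_eigen e A T"
    "\<And>e. transposition_eigen e {1..2} W \<Longrightarrow> transposition_eigen e ({1..5} - A) T"
    using tensor_prod_3_2_symmetries[OF order_at_most_symmetry_class[OF I(2)]
        order_at_most_symmetry_class[OF J(2)] T_eq] by metis
  interpret product: derivative_curvature_product sc a T A
    by unfold_locales (rule R A(1-3))+
  have U: "\<not> transposition_eigen (- 1) {1..3} U"
    using product.skew_eq_0 A(4) T(2) by blast
  have UW: "\<not> (transposition_eigen 1 {1..3} U \<and> transposition_eigen (- 1) {1..2} W)"
    using product.symmetric_skew_eq_0 A(4,5) T(2) by blast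
  \<comment> \<open>Of the six combinations of frames, fact \<open>U\<close> excludes the two with
    skew \<open>U\<close> and fact \<open>UW\<close> the one with symmetric \<open>U\<close> and
    skew \<open>W\<close>.\<close>
  from J show "belongs_to 3 I [3] \<and> belongs_to 2 J [2] \<and> symmetric_tensor 3 U \<and> symmetric_tensor 2 W
      \<or> belongs_to 3 I [2, 1] \<and> belongs_to 2 J [2] \<and> symmetric_tensor 2 W
      \<or> belongs_to 3 I [2, 1] \<and> belongs_to 2 J [1, 1] \<and> skew_tensor 2 W"
  proof (cases rule: irreducible_class_2_cases)
    case J_symmetric: symmetric
    from I show ?thesis
      by (cases rule: irreducible_class_3_cases) (use J_symmetric U in simp_all)
  next
    case J_skew: skew
    from I show ?thesis
      by (cases rule: irreducible_class_3_cases) (use J_skew U UW in simp_all)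
  qed
qed

end
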